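(* Let $(R,\mathbf m)$ be a one-dimensional Noetherian local ring, let $(\widehat R, \widehat{\mathbf m})$ denote the $\mathbf m$-adic completion of $R$, and let $\mathbf n$ denote the nilradical of $\widehat R$. If the length $\ell_{\widehat R}(\mathbf n)$ is finite, then the set $\mathcal G(R) = \{ g(Q) \mid Q \text{ is a parameter ideal of } R\}$ is finite.
   Context: A parameter ideal of a Noetherian local ring $(R,\mathbf m)$ of dimension $d$ is an $\mathbf m$-primary ideal generated by $d$ elements. The Goto number $g(Q)$ of a parameter ideal $Q$ is the largest integer $g$ such that $Q :_R \mathbf m^g \subseteq \overline{Q}$, where $\overline{Q}$ is the integral closure of the ideal $Q$. *)

theory Defs
  imports
    "HOL-Algebra.QuotRing"
    "HOL-Algebra.Ideal_Product"
    "HOL-Algebra.Module"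
    "HOL-Algebra.Ring_Divisibility"
    "HOL-Library.Extended_Nat"
begin

section \<open>Noetherian local rings and Krull dimension\<close>

locale noetherian_local_ring = cring R + noetherian_ring R + maximalideal M R
  for R :: "('a, 'b) ring_scheme" (structure) and M +
  assumes unique_maximal: "maximalideal N R \<Longrightarrow> N = M"

definition krull_dim :: "('a, 'b) ring_scheme \<Rightarrow> enat" where
  "krull_dim R =
     Sup {enat n | n. \<exists>P. (\<forall>i\<le>n. primeideal (P i) R) \<and> (\<forall>i<n. P i \<subset> P (Suc i))}"


section \<open>Operations on ideals\<close>

text \<open>The power is taken in the monoid of ideals under multiplication, so the zeroth power of
  every ideal is the whole ring.\<close>

abbreviation ideal_pow :: "('a, 'b) ring_scheme \<Rightarrow> 'a set \<Rightarrow> nat \<Rightarrow> 'a set" where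
  "ideal_pow R I n \<equiv> I [^]\<^bsub>ideals_set R\<^esub> n"

definition ideal_colon :: "('a, 'b) ring_scheme \<Rightarrow> 'a set \<Rightarrow> 'a set \<Rightarrow> 'a set" where
  "ideal_colon R I J = {r \<in> carrier R. \<forall>x\<in>J. r \<otimes>\<^bsub>R\<^esub> x \<in> I}"

definition radical :: "('a, 'b) ring_scheme \<Rightarrow> 'a set \<Rightarrow> 'a set" where
  "radical R I = {r \<in> carrier R. \<exists>n::nat. r [^]\<^bsub>R\<^esub> n \<in> I}"

definition nilradical :: "('a, 'b) ring_scheme \<Rightarrow> 'a set" where
  "nilradical R = radical R {\<zero>\<^bsub>R\<^esub>}"

locale primaryideal = ideal I R + cring R for I and R (structure) +
  assumes I_notcarr: "carrier R \<noteq> I"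
    and I_primary: "\<lbrakk>a \<in> carrier R; b \<in> carrier R; a \<otimes> b \<in> I\<rbrakk> \<Longrightarrow> a \<in> I \<or> b \<in> radical R I"

text \<open>An element is integral over \<open>I\<close> if it satisfies an equation
  \<open>r^n + a\<^sub>1 r^(n-1) + \<dots> + a\<^sub>n = 0\<close> with \<open>a\<^sub>i \<in> I^i\<close>.\<close>

definition ideal_integral_closure :: "('a, 'b) ring_scheme \<Rightarrow> 'a set \<Rightarrow> 'a set" where
  "ideal_integral_closure R I =
     {r \<in> carrier R. \<exists>n::nat. n \<ge> 1 \<and>
        (\<exists>a. (\<forall>i\<in>{1..n}. a i \<in> ideal_pow R I i) \<and>
             r [^]\<^bsub>R\<^esub> n \<oplus>\<^bsub>R\<^esub> (\<Oplus>\<^bsub>R\<^esub>i\<in>{1..n}. a i \<otimes>\<^bsub>R\<^esub> r [^]\<^bsub>R\<^esub> (n - i)) = \<zero>\<^bsub>R\<^esub>)}"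


section \<open>Length of a module\<close>

definition module_length :: "('r, 's) ring_scheme \<Rightarrow> ('r, 'm, 't) module_scheme \<Rightarrow> enat" where
  "module_length R M =
     Sup {enat n | n. \<exists>N. (\<forall>i\<le>n. submodule (N i) R M) \<and> (\<forall>i<n. N i \<subset> N (Suc i))}"

text \<open>An ideal of \<open>R\<close> regarded as an \<open>R\<close>-module. The fields \<open>monoid.mult\<close> and \<open>one\<close> of the record
  play no role in the module structure.\<close>

definition ideal_module :: "('a, 'b) ring_scheme \<Rightarrow> 'a set \<Rightarrow> ('a, 'a) module" where
  "ideal_module R I =
     \<lparr>carrier = I, monoid.mult = monoid.mult R, one = one R,
      zero = zero R, add = add R, smult = monoid.mult R\<rparr>"

lemma (in cring) ideal_module_module:
  assumes "ideal I R" shows "module R (ideal_module R I)"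
proof -
  interpret I: ideal I R by fact
  show ?thesis
  proof (intro moduleI abelian_groupI)
    show "\<exists>y\<in>carrier (ideal_module R I). y \<oplus>\<^bsub>ideal_module R I\<^esub> x = \<zero>\<^bsub>ideal_module R I\<^esub>"
      if "x \<in> carrier (ideal_module R I)" for x
      using that I.a_inv_closed[of x] I.Icarr[of x] l_neg[of x]
      by (intro bexI[of _ "\<ominus> x"]) (simp_all add: ideal_module_def)
  qed (simp_all add: ideal_module_def cring_axioms I.Icarr a_ac I.I_l_closed
      l_distr r_distr m_assoc)
qed


section \<open>Adic completion\<close>

text \<open>The inverse limit of the rings \<open>R / I^n\<close>. A coset of \<open>I^(n+1)\<close> is mapped by the
  transition homomorphism to the unique coset of \<open>I^n\<close> that contains it, so compatibility of a
  sequence of cosets is the inclusion \<open>x (Suc n) \<subseteq> x n\<close>.\<close>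

definition adic_completion :: "('a, 'b) ring_scheme \<Rightarrow> 'a set \<Rightarrow> (nat \<Rightarrow> 'a set) ring" where
  "adic_completion R I =
     \<lparr>carrier = {x. (\<forall>n. x n \<in> carrier (R Quot ideal_pow R I n)) \<and> (\<forall>n. x (Suc n) \<subseteq> x n)},
      monoid.mult = (\<lambda>x y n. x n \<otimes>\<^bsub>R Quot ideal_pow R I n\<^esub> y n),
      one = (\<lambda>n. \<one>\<^bsub>R Quot ideal_pow R I n\<^esub>),
      zero = (\<lambda>n. \<zero>\<^bsub>R Quot ideal_pow R I n\<^esub>),
      add = (\<lambda>x y n. x n \<oplus>\<^bsub>R Quot ideal_pow R I n\<^esub> y n)\<rparr>"

lemma (in cring) ideal_pow_ideal: "ideal I R \<Longrightarrow> ideal (ideal_pow R I n) R"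
proof -
  assume I: "ideal I R"
  interpret S: comm_monoid "ideals_set R" by (rule ideals_set_is_comm_monoid)
  have "I \<in> carrier (ideals_set R)" using I by (simp add: ideals_set_def)
  hence "ideal_pow R I n \<in> carrier (ideals_set R)" by (rule S.nat_pow_closed)
  thus ?thesis by (simp add: ideals_set_def)
qed

lemma (in cring) ideal_pow_Suc: "ideal I R \<Longrightarrow> ideal_pow R I (Suc n) \<subseteq> ideal_pow R I n"
proof -
  assume I: "ideal I R"
  interpret S: comm_monoid "ideals_set R" by (rule ideals_set_is_comm_monoid)
  have "ideal_pow R I (Suc n) = ideal_prod R (ideal_pow R I n) I"
    by (simp add: ideals_set_def nat_pow_def)
  thus ?thesis using ideal_prod_inter[OF ideal_pow_ideal[OF I, of n] I] by auto
qed

lemma (in cring) adic_completion_cring: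
  assumes I: "ideal I R" shows "cring (adic_completion R I)"
proof -
  have Q: "cring (R Quot ideal_pow R I n)" for n
    using ideal.quotient_is_cring[OF ideal_pow_ideal[OF I] cring_axioms] .
  have addsub: "set_add R a b \<subseteq> set_add R c d" if "a \<subseteq> c" "b \<subseteq> d" for a b c d
    using that by (auto simp: set_add_def set_mult_def)
  have multsub: "rcoset_mult R (ideal_pow R I (Suc n)) a b \<subseteq> rcoset_mult R (ideal_pow R I n) c d"
    if "a \<subseteq> c" "b \<subseteq> d" for a b c d n
    unfolding rcoset_mult_def a_r_coset_def r_coset_def
    by (intro UN_mono that order_refl ideal_pow_Suc[OF I])
  let ?A = "adic_completion R I"
  have car: "x n \<in> carrier (R Quot ideal_pow R I n)" if "x \<in> carrier ?A" for x n
    using that by (simp add: adic_completion_def)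
  have inc: "x (Suc n) \<subseteq> x n" if "x \<in> carrier ?A" for x n
    using that by (simp add: adic_completion_def)
  have add: "add ?A x y = (\<lambda>n. x n \<oplus>\<^bsub>R Quot ideal_pow R I n\<^esub> y n)" for x y
    by (simp add: adic_completion_def)
  have mul: "monoid.mult ?A x y = (\<lambda>n. x n \<otimes>\<^bsub>R Quot ideal_pow R I n\<^esub> y n)" for x y
    by (simp add: adic_completion_def)
  have zer: "\<zero>\<^bsub>?A\<^esub> = (\<lambda>n. \<zero>\<^bsub>R Quot ideal_pow R I n\<^esub>)" by (simp add: adic_completion_def)
  have on: "\<one>\<^bsub>?A\<^esub> = (\<lambda>n. \<one>\<^bsub>R Quot ideal_pow R I n\<^esub>)" by (simp add: adic_completion_def)
  have addc: "add ?A x y \<in> carrier ?A" if "x \<in> carrier ?A" "y \<in> carrier ?A" for x y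
    using car[OF that(1)] car[OF that(2)] inc[OF that(1)] inc[OF that(2)]
       cring.cring_simprules(1)[OF Q] addsub
    by (auto simp: adic_completion_def FactRing_def)
  have mulc: "monoid.mult ?A x y \<in> carrier ?A" if "x \<in> carrier ?A" "y \<in> carrier ?A" for x y
    unfolding mul using car[OF that(1)] car[OF that(2)] multsub[OF inc[OF that(1)] inc[OF that(2)]]
       cring.cring_simprules(5)[OF Q]
    by (simp add: adic_completion_def) (simp add: FactRing_def)
  have zc: "\<zero>\<^bsub>?A\<^esub> \<in> carrier ?A"
    using cring.cring_simprules(2)[OF Q] ideal_pow_Suc[OF I]
    by (auto simp: adic_completion_def FactRing_def)
  have oc: "\<one>\<^bsub>?A\<^esub> \<in> carrier ?A"
    using cring.cring_simprules(6)[OF Q] ideal_pow_Suc[OF I]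
    by (simp add: adic_completion_def) (auto simp add: FactRing_def a_r_coset_def r_coset_def)
  have neg: "\<exists>y\<in>carrier ?A. add ?A y x = \<zero>\<^bsub>?A\<^esub>" if x: "x \<in> carrier ?A" for x
  proof -
    let ?m = "\<lambda>n. \<ominus>\<^bsub>R Quot ideal_pow R I n\<^esub> \<one>\<^bsub>R Quot ideal_pow R I n\<^esub>"
    have m: "?m n = ideal_pow R I n +>\<^bsub>R\<^esub> \<ominus> \<one>" for n
      using ring_hom_cring.hom_a_inv[OF ideal.rcos_ring_hom_cring[OF ideal_pow_ideal[OF I] cring_axioms], of \<one> n]
      by (simp add: FactRing_def)
    have "?m n \<in> carrier (R Quot ideal_pow R I n)" for n
      using cring.cring_simprules(3)[OF Q cring.cring_simprules(6)[OF Q]] .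
    moreover have "?m (Suc n) \<subseteq> ?m n" for n
      unfolding m a_r_coset_def r_coset_def
      by (intro UN_mono order_refl) (use ideal_pow_Suc[OF I, of n] in auto)
    ultimately have "?m \<in> carrier ?A"
      unfolding adic_completion_def by (simp del: nat_pow_Suc)
    hence "monoid.mult ?A ?m x \<in> carrier ?A" using x mulc by blast
    moreover have "add ?A (monoid.mult ?A ?m x) x = \<zero>\<^bsub>?A\<^esub>"
      unfolding add mul zer
    proof
      fix n
      interpret q: cring "R Quot ideal_pow R I n" by (rule Q)
      show "?m n \<otimes>\<^bsub>R Quot ideal_pow R I n\<^esub> x n \<oplus>\<^bsub>R Quot ideal_pow R I n\<^esub> x n = \<zero>\<^bsub>R Quot ideal_pow R I n\<^esub>"
        using car[OF x, of n] by (simp add: q.l_minus q.l_neg)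
    qed
    ultimately show ?thesis by blast
  qed
  show ?thesis
  proof (intro cringI abelian_groupI comm_monoidI)
    fix x y z assume x: "x \<in> carrier ?A" and y: "y \<in> carrier ?A" and z: "z \<in> carrier ?A"
    note c = car[OF x] car[OF y] car[OF z]
    show "x \<oplus>\<^bsub>?A\<^esub> y \<oplus>\<^bsub>?A\<^esub> z = x \<oplus>\<^bsub>?A\<^esub> (y \<oplus>\<^bsub>?A\<^esub> z)"
      unfolding add by (intro ext cring.cring_simprules(7)[OF Q] c)
    show "x \<otimes>\<^bsub>?A\<^esub> y \<otimes>\<^bsub>?A\<^esub> z = x \<otimes>\<^bsub>?A\<^esub> (y \<otimes>\<^bsub>?A\<^esub> z)"
      unfolding mul by (intro ext cring.cring_simprules(11)[OF Q] c)
    show "(x \<oplus>\<^bsub>?A\<^esub> y) \<otimes>\<^bsub>?A\<^esub> z = x \<otimes>\<^bsub>?A\<^esub> z \<oplus>\<^bsub>?A\<^esub> y \<otimes>\<^bsub>?A\<^esub> z"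
      unfolding mul add by (intro ext cring.cring_simprules(13)[OF Q] c)
  next
    fix x y assume x: "x \<in> carrier ?A" and y: "y \<in> carrier ?A"
    show "x \<oplus>\<^bsub>?A\<^esub> y = y \<oplus>\<^bsub>?A\<^esub> x"
      unfolding add by (intro ext cring.cring_simprules(10)[OF Q] car x y)
    show "x \<otimes>\<^bsub>?A\<^esub> y = y \<otimes>\<^bsub>?A\<^esub> x"
      unfolding mul by (intro ext cring.cring_simprules(14)[OF Q] car x y)
  next
    fix x assume x: "x \<in> carrier ?A"
    show "\<zero>\<^bsub>?A\<^esub> \<oplus>\<^bsub>?A\<^esub> x = x"
      unfolding add zer by (intro ext cring.cring_simprules(8)[OF Q] car x)
    show "\<one>\<^bsub>?A\<^esub> \<otimes>\<^bsub>?A\<^esub> x = x"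
      unfolding mul on by (intro ext cring.cring_simprules(12)[OF Q] car x)
  qed (fact addc mulc zc oc neg)+
qed


section \<open>Parameter ideals and Goto numbers\<close>

text \<open>Below, \<open>M\<close> is the maximal ideal of the local ring \<open>R\<close>.\<close>

definition parameter_ideal :: "('a, 'b) ring_scheme \<Rightarrow> 'a set \<Rightarrow> 'a set \<Rightarrow> bool" where
  "parameter_ideal R M Q \<longleftrightarrow>
     primaryideal Q R \<and> radical R Q = M \<and>
     (\<exists>xs. set xs \<subseteq> carrier R \<and> enat (length xs) = krull_dim R \<and> Q = Idl\<^bsub>R\<^esub> (set xs))"

text \<open>For a parameter ideal \<open>Q\<close> the maximum exists: \<open>g = 0\<close> satisfies the condition, while
  \<open>M^g \<subseteq> Q\<close> for all large \<open>g\<close>, where the colon ideal is \<open>R\<close>.\<close>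

definition goto_number :: "('a, 'b) ring_scheme \<Rightarrow> 'a set \<Rightarrow> 'a set \<Rightarrow> nat" where
  "goto_number R M Q =
     (GREATEST g. ideal_colon R Q (ideal_pow R M g) \<subseteq> ideal_integral_closure R Q)"

definition goto_numbers :: "('a, 'b) ring_scheme \<Rightarrow> 'a set \<Rightarrow> nat set" where
  "goto_numbers R M = {goto_number R M Q | Q. parameter_ideal R M Q}"

end

theory Submission
  imports Defs
begin

text \<open>Suppose that a fixed power \<open>M^k\<close> multiplies the integral closure of every parameter ideal
  \<open>Q = yR\<close> into \<open>Q\<close>. A socle element \<open>a\<close> of \<open>R\<close> modulo that closure then satisfies
  \<open>a M^(k+1) \<subseteq> Q\<close>, so \<open>g(Q) \<le> k\<close>.

  To find \<open>k\<close>, fix one parameter \<open>x\<close> and let \<open>J n\<close> be the closure of \<open>x^n R\<close>. An element \<open>r\<close> of \<open>J n\<close>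
  satisfies an integral equation over \<open>x^n R\<close> of degree bounded independently of \<open>n\<close>, up to
  \<open>x\<close>-torsion. Hence the limit in the completion of a Cauchy sequence with terms \<open>r j \<in> J j\<close> becomes
  nilpotent after multiplication by \<open>x\<close>, and is annihilated by a fixed power of \<open>x\<close>, because the
  nilradical has finite length. By compactness (Chevalley) some \<open>J n\<close> satisfies
  \<open>x^L (J n) \<subseteq> x^(L+1) R\<close>; dividing by \<open>x\<close> repeatedly gives \<open>x^L (J (n + j)) \<subseteq> x^(L+j) R\<close>. If
  \<open>x^p = y z\<close>, multiplication by \<open>z\<close> maps the closure of \<open>yR\<close> into \<open>J p\<close>, which transfers the bound from
  \<open>x\<close> to \<open>y\<close>.

  Integral closure is replaced throughout by the larger set of elements \<open>r\<close> such that
  \<open>y^c r^m \<in> y^m R\<close> for some \<open>c\<close> and all \<open>m\<close>, which is visibly an ideal.\<close>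

section \<open>Ideals of commutative rings\<close>

context cring
begin

lemma PIdl_iff: "a \<in> PIdl x \<longleftrightarrow> (\<exists>r\<in>carrier R. a = x \<otimes> r)" if "x \<in> carrier R"
  using that by (auto simp: cgenideal_def m_comm)

lemma PIdl_multI: "x \<in> carrier R \<Longrightarrow> r \<in> carrier R \<Longrightarrow> x \<otimes> r \<in> PIdl x"
  by (auto simp: PIdl_iff)

lemma PIdl_pow_mono:
  assumes "x \<in> carrier R" "i \<le> (j::nat)"
  shows "PIdl (x [^] j) \<subseteq> PIdl (x [^] i)"
proof
  fix a assume "a \<in> PIdl (x [^] j)"
  then obtain r where r: "r \<in> carrier R" "a = x [^] j \<otimes> r" using assms by (auto simp: PIdl_iff)
  have "a = x [^] i \<otimes> (x [^] (j - i) \<otimes> r)"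
    using r assms by (simp add: m_assoc[symmetric] nat_pow_mult)
  thus "a \<in> PIdl (x [^] i)" using r assms by (simp add: PIdl_multI)
qed

lemma cring_idealI:
  assumes "S \<subseteq> carrier R" "\<zero> \<in> S" "\<And>a b. a \<in> S \<Longrightarrow> b \<in> S \<Longrightarrow> a \<oplus> b \<in> S"
    and "\<And>a r. a \<in> S \<Longrightarrow> r \<in> carrier R \<Longrightarrow> r \<otimes> a \<in> S"
  shows "ideal S R"
proof (rule idealI)
  show "subgroup S (add_monoid R)"
  proof (rule add.subgroupI)
    fix a assume a: "a \<in> S"
    hence "(\<ominus> \<one>) \<otimes> a \<in> S" using assms(4)[OF a, of "\<ominus> \<one>"] by simp
    thus "\<ominus> a \<in> S" using a assms(1) by (auto simp: l_minus)
  qed (use assms in auto)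
next
  fix a r assume "a \<in> S" "r \<in> carrier R"
  thus "r \<otimes> a \<in> S" "a \<otimes> r \<in> S" using assms by (auto simp: m_comm[of a r] subset_eq)
qed (rule ring_axioms)

lemma ideal_vimage_mult:
  assumes "ideal A R" "x \<in> carrier R"
  shows "ideal {a \<in> carrier R. x \<otimes> a \<in> A} R"
proof -
  interpret A: ideal A R by fact
  show ?thesis
    by (rule cring_idealI)
      (use assms(2) in \<open>auto simp: r_distr A.a_closed m_lcomm[of x] A.I_l_closed\<close>)
qed

lemma ideal_image_mult:
  assumes "ideal A R" "x \<in> carrier R"
  shows "ideal ((\<otimes>) x ` A) R"
proof -
  interpret A: ideal A R by fact
  have c: "x \<otimes> a \<oplus> x \<otimes> b = x \<otimes> (a \<oplus> b)" if "a \<in> A" "b \<in> A" for a b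
    using that assms(2) by (simp add: r_distr A.Icarr)
  have d: "r \<otimes> (x \<otimes> a) = x \<otimes> (r \<otimes> a)" if "a \<in> A" "r \<in> carrier R" for a r
    using that assms(2) by (simp add: m_lcomm A.Icarr)
  have z: "\<zero> \<in> (\<otimes>) x ` A" using assms(2) A.zero_closed by (intro image_eqI[where x = \<zero>]) auto
  show ?thesis
    by (rule cring_idealI)
      (use assms(2) z in \<open>auto simp: c d A.a_closed A.I_l_closed A.Icarr intro!: imageI\<close>)
qed

lemma ideal_carrier: "ideal A R \<Longrightarrow> A \<subseteq> carrier R"
  by (auto simp: ideal.Icarr)

lemma mem_add_ideals_iff: "a \<in> A <+>\<^bsub>R\<^esub> B \<longleftrightarrow> (\<exists>b\<in>A. \<exists>c\<in>B. a = b \<oplus> c)"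
  by (auto simp: set_add_def')

lemma subset_add_ideals1:
  assumes "ideal A R" "ideal B R" shows "A \<subseteq> A <+>\<^bsub>R\<^esub> B"
proof
  fix a assume "a \<in> A"
  moreover have "a = a \<oplus> \<zero>" using ideal.Icarr[OF assms(1) \<open>a \<in> A\<close>] by simp
  moreover have "\<zero> \<in> B" using additive_subgroup.zero_closed[OF ideal.axioms(1)[OF assms(2)]] .
  ultimately show "a \<in> A <+>\<^bsub>R\<^esub> B" unfolding mem_add_ideals_iff by blast
qed

lemma subset_add_ideals2:
  assumes "ideal A R" "ideal B R" shows "B \<subseteq> A <+>\<^bsub>R\<^esub> B"
  using subset_add_ideals1[OF assms(2,1)] assms by (simp add: set_add_comm ideal_carrier)

lemma add_ideals_least: "ideal C R \<Longrightarrow> A \<subseteq> C \<Longrightarrow> B \<subseteq> C \<Longrightarrow> A <+>\<^bsub>R\<^esub> B \<subseteq> C"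
  using additive_subgroup.a_closed[OF ideal.axioms(1), of C R] by (auto simp: mem_add_ideals_iff subset_eq)

lemma add_ideals_absorb:
  assumes "ideal A R" "ideal B R" "A \<subseteq> B"
  shows "A <+>\<^bsub>R\<^esub> B = B"
  using add_ideals_least[OF assms(2) assms(3)] subset_add_ideals2[OF assms(1,2)] by auto

lemma add_ideals_mono: "A \<subseteq> A' \<Longrightarrow> B \<subseteq> B' \<Longrightarrow> A <+>\<^bsub>R\<^esub> B \<subseteq> A' <+>\<^bsub>R\<^esub> B'"
  unfolding set_add_def' by blast

text \<open>Modular law. A strict inclusion of \<open>D\<close> in \<open>C\<close> therefore stays
  strict after intersecting with \<open>B\<close> or after adding \<open>B\<close>.\<close>

lemma ideal_modular_cancel:
  assumes D: "ideal D R" and C: "ideal C R" and B: "ideal B R"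
    and "D \<subseteq> C" "D \<inter> B = C \<inter> B" "D <+>\<^bsub>R\<^esub> B = C <+>\<^bsub>R\<^esub> B"
  shows "D = C"
proof
  interpret D: ideal D R by fact
  interpret C: ideal C R by fact
  interpret B: ideal B R by fact
  show "C \<subseteq> D"
  proof
    fix c assume c: "c \<in> C"
    hence "c \<in> D <+>\<^bsub>R\<^esub> B" using subset_add_ideals1[OF C B] assms(6) by auto
    then obtain d b where db: "d \<in> D" "b \<in> B" "c = d \<oplus> b" by (auto simp: mem_add_ideals_iff)
    have "b = \<ominus> d \<oplus> c" using db D.Icarr B.Icarr by (simp add: r_neg1)
    moreover have "\<ominus> d \<in> C" using db assms(4) by (auto intro!: C.a_inv_closed)
    ultimately have "b \<in> C" using c C.a_closed by blast
    thus "c \<in> D" using db assms(5) by auto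
  qed
qed fact

text \<open>A binomial expansion without coefficients: one factor \<open>r \<oplus> s\<close> is
  expanded at a time, and \<open>c\<close> absorbs the factors already chosen.\<close>

lemma mem_add_pow_closed:
  fixes m :: nat
  assumes I: "ideal I R" and [simp]: "r \<in> carrier R" "s \<in> carrier R"
    and "c \<in> carrier R" "\<And>i j. i + j = m \<Longrightarrow> c \<otimes> r [^] i \<otimes> s [^] j \<in> I"
  shows "c \<otimes> (r \<oplus> s) [^] m \<in> I"
  using assms(4,5)
proof (induction m arbitrary: c)
  case 0
  thus ?case using "0.prems"(2)[of 0 0] by simp
next
  case (Suc m)
  interpret I: ideal I R by fact
  note [simp] = Suc.prems(1)
  have 1: "(c \<otimes> r) \<otimes> (r \<oplus> s) [^] m \<in> I"
  proof (rule Suc.IH)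
    fix i j assume "i + j = m"
    hence "c \<otimes> r [^] Suc i \<otimes> s [^] j \<in> I" by (intro Suc.prems) auto
    thus "c \<otimes> r \<otimes> r [^] i \<otimes> s [^] j \<in> I" by (simp add: m_ac)
  qed simp
  have 2: "(c \<otimes> s) \<otimes> (r \<oplus> s) [^] m \<in> I"
  proof (rule Suc.IH)
    fix i j assume "i + j = m"
    hence "c \<otimes> r [^] i \<otimes> s [^] Suc j \<in> I" by (intro Suc.prems) auto
    thus "c \<otimes> s \<otimes> r [^] i \<otimes> s [^] j \<in> I" by (simp add: m_ac)
  qed simp
  have "c \<otimes> (r \<oplus> s) [^] Suc m = (c \<otimes> r) \<otimes> (r \<oplus> s) [^] m \<oplus> (c \<otimes> s) \<otimes> (r \<oplus> s) [^] m"
    by (simp add: r_distr l_distr m_ac)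
  thus ?case using 1 2 by simp
qed

lemma radical_ideal:
  assumes "ideal I R"
  shows "ideal (radical R I) R"
proof (rule cring_idealI)
  interpret I: ideal I R by fact
  show "radical R I \<subseteq> carrier R" by (auto simp: radical_def)
  show "\<zero> \<in> radical R I" by (auto simp: radical_def intro!: exI[of _ "1::nat"])
  fix a assume "a \<in> radical R I"
  then obtain p where [simp]: "a \<in> carrier R" and p: "a [^] (p::nat) \<in> I" by (auto simp: radical_def)
  {
    fix b assume "b \<in> radical R I"
    then obtain q where [simp]: "b \<in> carrier R" and q: "b [^] (q::nat) \<in> I" by (auto simp: radical_def)
    \<comment> \<open>If i + j = p + q, then i \<ge> p or j \<ge> q, so every mixed term lies in
      \<open>I\<close>.\<close>
    have "\<one> \<otimes> (a \<oplus> b) [^] (p + q) \<in> I"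
    proof (rule mem_add_pow_closed[OF assms])
      fix i j assume ij: "i + j = p + q"
      show "\<one> \<otimes> a [^] i \<otimes> b [^] j \<in> I"
      proof (cases "p \<le> i")
        case True
        hence "a [^] i = a [^] p \<otimes> a [^] (i - p)" by (simp add: nat_pow_mult)
        thus ?thesis using p by (simp add: I.I_r_closed)
      next
        case False
        hence "b [^] j = b [^] q \<otimes> b [^] (j - q)" using ij by (simp add: nat_pow_mult)
        thus ?thesis using q by (simp add: I.I_r_closed I.I_l_closed)
      qed
    qed simp_all
    thus "a \<oplus> b \<in> radical R I" by (auto simp: radical_def simp del: nat_pow_mult intro!: exI[of _ "p + q"])
  }
  {
    fix r assume "r \<in> carrier R"
    thus "r \<otimes> a \<in> radical R I"
      using p by (auto simp: radical_def nat_pow_distrib I.I_l_closed intro!: exI[of _ p])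
  }
qed

end

section \<open>Chains of ideals\<close>

text \<open>Lengths of quotients B/A are measured inside R: the supremum of the admissible
  \<open>h\<close> is that length. The bottom ideal only has to contain \<open>A\<close>, which
  makes the predicate monotone in both ends.\<close>

primrec ideal_chain :: "('a, 'b) ring_scheme \<Rightarrow> nat \<Rightarrow> 'a set \<Rightarrow> 'a set \<Rightarrow> bool" where
  "ideal_chain R 0 A B \<longleftrightarrow> ideal A R \<and> ideal B R \<and> A \<subseteq> B"
| "ideal_chain R (Suc h) A B \<longleftrightarrow> ideal B R \<and> (\<exists>C. ideal_chain R h A C \<and> C \<subset> B)"

context cring
begin

lemma ideal_chainD:
  "ideal_chain R h A B \<Longrightarrow> ideal A R \<and> ideal B R \<and> A \<subseteq> B"
  by (induction h arbitrary: B) auto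

lemma ideal_chain_mono:
  "ideal_chain R h A B \<Longrightarrow> ideal B' R \<Longrightarrow> B \<subseteq> B' \<Longrightarrow> ideal_chain R h A B'"
  by (cases h) (simp_all, blast, meson psubset_subset_trans)

lemma ideal_chain_antimono:
  "ideal_chain R h A B \<Longrightarrow> ideal A' R \<Longrightarrow> A' \<subseteq> A \<Longrightarrow> ideal_chain R h A' B"
  by (induction h arbitrary: B) auto

lemma ideal_chain_trans:
  "ideal_chain R h A B \<Longrightarrow> ideal_chain R k B C \<Longrightarrow> ideal_chain R (h + k) A C"
proof (induction k arbitrary: C)
  case 0 thus ?case by (auto intro: ideal_chain_mono)
next
  case (Suc k) thus ?case by auto
qed

text \<open>By modular cancellation each strict step survives in the intersection or in the sum with
  \<open>B\<close>. In terms of lengths, l(C/A) is at most the length between the intersections plus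
  the length between the sums.\<close>

lemma ideal_chain_split:
  assumes "ideal_chain R h A C" "ideal B R"
  shows "\<exists>p q. h \<le> p + q \<and> ideal_chain R p (A \<inter> B) (C \<inter> B) \<and> ideal_chain R q (A <+>\<^bsub>R\<^esub> B) (C <+>\<^bsub>R\<^esub> B)"
  using assms(1)
proof (induction h arbitrary: C)
  case 0
  hence "ideal_chain R 0 (A \<inter> B) (C \<inter> B) \<and> ideal_chain R 0 (A <+>\<^bsub>R\<^esub> B) (C <+>\<^bsub>R\<^esub> B)"
    using assms(2) add_ideals_mono[of A C B B] by (auto simp: i_intersect add_ideals)
  thus ?case by blast
next
  case (Suc h)
  then obtain D where D: "ideal_chain R h A D" "D \<subset> C" "ideal C R" by auto
  then obtain p q where pq: "h \<le> p + q" "ideal_chain R p (A \<inter> B) (D \<inter> B)"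
    "ideal_chain R q (A <+>\<^bsub>R\<^esub> B) (D <+>\<^bsub>R\<^esub> B)" using Suc.IH by blast
  have idl: "ideal D R" "ideal (C \<inter> B) R" "ideal (C <+>\<^bsub>R\<^esub> B) R"
    using ideal_chainD[OF D(1)] D(3) assms(2) by (auto simp: i_intersect add_ideals)
  have sub: "D \<inter> B \<subseteq> C \<inter> B" "D <+>\<^bsub>R\<^esub> B \<subseteq> C <+>\<^bsub>R\<^esub> B"
    using D(2) add_ideals_mono[of D C B B] by auto
  consider "D \<inter> B \<noteq> C \<inter> B" | "D <+>\<^bsub>R\<^esub> B \<noteq> C <+>\<^bsub>R\<^esub> B"
    using ideal_modular_cancel[OF idl(1) D(3) assms(2)] D(2) by blast
  thus ?case
  proof cases
    case 1
    hence "ideal_chain R (Suc p) (A \<inter> B) (C \<inter> B)" "ideal_chain R q (A <+>\<^bsub>R\<^esub> B) (C <+>\<^bsub>R\<^esub> B)"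
      using pq sub idl by (auto intro: ideal_chain_mono)
    thus ?thesis using pq(1) by (intro exI[of _ "Suc p"] exI[of _ q]) simp
  next
    case 2
    hence "ideal_chain R p (A \<inter> B) (C \<inter> B)" "ideal_chain R (Suc q) (A <+>\<^bsub>R\<^esub> B) (C <+>\<^bsub>R\<^esub> B)"
      using pq sub idl by (auto intro: ideal_chain_mono)
    thus ?thesis using pq(1) by (intro exI[of _ p] exI[of _ "Suc q"]) simp
  qed
qed

lemma ideal_chain_split_between:
  assumes "ideal_chain R h A C" "ideal B R" "A \<subseteq> B" "B \<subseteq> C"
  obtains p q where "h \<le> p + q" "ideal_chain R p A B" "ideal_chain R q B C"
proof -
  note A = ideal_chainD[OF assms(1)]
  have "A \<inter> B = A" "C \<inter> B = B" "A <+>\<^bsub>R\<^esub> B = B" using assms A add_ideals_absorb by auto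
  moreover have "C <+>\<^bsub>R\<^esub> B = C"
    using add_ideals_least[of C C B] subset_add_ideals1[of C B] A assms by auto
  ultimately show ?thesis using ideal_chain_split[OF assms(1,2)] that by auto
qed

text \<open>Ideals inside xR consist of multiples of \<open>x\<close>, so they are determined by
  their preimages under multiplication by \<open>x\<close>, and strict steps remain strict.\<close>

lemma ideal_chain_vimage_mult:
  assumes "ideal_chain R h A B" "B \<subseteq> PIdl x" "x \<in> carrier R"
  shows "ideal_chain R h {a \<in> carrier R. x \<otimes> a \<in> A} {a \<in> carrier R. x \<otimes> a \<in> B}"
  using assms(1,2)
proof (induction h arbitrary: B)
  case 0
  thus ?case using assms(3) by (auto simp: ideal_vimage_mult)
next
  case (Suc h)
  then obtain C where C: "ideal_chain R h A C" "C \<subset> B" by auto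
  then obtain b where b: "b \<in> B" "b \<notin> C" by auto
  hence "b \<in> PIdl x" using Suc.prems(2) by blast
  then obtain a where a: "a \<in> carrier R" "b = x \<otimes> a" using assms(3) by (auto simp: PIdl_iff)
  have "{a \<in> carrier R. x \<otimes> a \<in> C} \<subset> {a \<in> carrier R. x \<otimes> a \<in> B}"
    using C(2) a b by blast
  moreover have "ideal_chain R h {a \<in> carrier R. x \<otimes> a \<in> A} {a \<in> carrier R. x \<otimes> a \<in> C}"
    using Suc.IH[OF C(1)] C(2) Suc.prems(2) by blast
  moreover have "ideal {a \<in> carrier R. x \<otimes> a \<in> B} R"
    using ideal_vimage_mult[OF _ assms(3)] ideal_chainD[OF Suc.prems(1)] by blast
  ultimately show ?case unfolding ideal_chain.simps by blast
qed

text \<open>\<open>\<ell>(R/I) + \<ell>(I/xI) = \<ell>(R/xI) = \<ell>(R/xR) + \<ell>(xR/xI)\<close>, and \<open>xR/xI\<close> is a quotient of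
  \<open>R/I\<close>.\<close>

lemma ideal_chain_mult_bound:
  assumes x: "x \<in> carrier R" and I: "ideal I R"
    and e: "\<And>h. ideal_chain R h (PIdl x) (carrier R) \<Longrightarrow> h \<le> e"
    and l: "\<And>h. ideal_chain R h I (carrier R) \<Longrightarrow> h \<le> l"
    and ch: "ideal_chain R h ((\<otimes>) x ` I) I"
  shows "h \<le> e"
proof -
  interpret I: ideal I R by fact
  let ?xI = "(\<otimes>) x ` I"
  have "ideal_chain R 0 I (carrier R)" using I I.Icarr by (auto simp: oneideal)
  \<comment> \<open>\<open>n\<close> is the exact length of R/I. It occurs on both sides of the
    count and cancels, so the bound \<open>l\<close>, which makes the maximum exist, does not enter
    the result.\<close>
  define n where "n = (GREATEST h. ideal_chain R h I (carrier R))"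
  have n: "ideal_chain R n I (carrier R)" "\<And>k. ideal_chain R k I (carrier R) \<Longrightarrow> k \<le> n"
    unfolding n_def
    using GreatestI_nat[of "\<lambda>h. ideal_chain R h I (carrier R)" 0 l]
      Greatest_le_nat[of "\<lambda>h. ideal_chain R h I (carrier R)" _ l] l
      \<open>ideal_chain R 0 I (carrier R)\<close> by simp_all
  have xI: "ideal ?xI R" by (rule ideal_image_mult[OF I x])
  have "ideal_chain R (h + n) ?xI (carrier R)" by (rule ideal_chain_trans[OF ch n(1)])
  moreover have "?xI \<subseteq> PIdl x" using x I.Icarr by (auto simp: PIdl_multI)
  ultimately obtain p q where pq: "h + n \<le> p + q" "ideal_chain R p ?xI (PIdl x)"
    "ideal_chain R q (PIdl x) (carrier R)"
    using ideal_chain_split_between[OF _ cgenideal_ideal[OF x]] ideal_carrier[OF cgenideal_ideal[OF x]]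
    by metis
  \<comment> \<open>The preimage of xR is R and the preimage of xI contains \<open>I\<close>, so the
    chain from xI to xR turns into one of the same length from \<open>I\<close> to R.\<close>
  have "{a \<in> carrier R. x \<otimes> a \<in> PIdl x} = carrier R" using x by (auto simp: PIdl_multI)
  hence "ideal_chain R p {a \<in> carrier R. x \<otimes> a \<in> ?xI} (carrier R)"
    using ideal_chain_vimage_mult[OF pq(2) order_refl x] by simp
  hence "ideal_chain R p I (carrier R)"
    by (rule ideal_chain_antimono) (use I I.Icarr in auto)
  hence "p \<le> n" by (rule n(2))
  moreover have "q \<le> e" using e[OF pq(3)] .
  ultimately show ?thesis using pq(1) by simp
qed

lemma descending_ideals_stable:
  assumes l: "\<And>h. ideal_chain R h A B \<Longrightarrow> h \<le> (l::nat)"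
    and D: "\<And>n. ideal (D n) R" "\<And>n. A \<subseteq> D n" "\<And>n. D n \<subseteq> B" "\<And>n. D (Suc n) \<subseteq> D n"
    and AB: "ideal A R" "ideal B R"
  shows "\<exists>n. \<forall>k\<ge>n. D k = D n"
proof (rule ccontr)
  assume "\<not> ?thesis"
  hence *: "\<exists>k\<ge>n. D k \<noteq> D n" for n by blast
  have anti: "D k \<subseteq> D n" if "n \<le> k" for n k
    using lift_Suc_antimono_le[of D, OF D(4) that] .
  have "\<exists>n. ideal_chain R h (D n) B" for h
  proof (induction h)
    case 0 show ?case using D AB by auto
  next
    case (Suc h)
    then obtain n where n: "ideal_chain R h (D n) B" by blast
    obtain k where k: "k \<ge> n" "D k \<noteq> D n" using * by blast
    have "D k \<subset> D n" using k anti[OF k(1)] by blast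
    hence "ideal_chain R 1 (D k) (D n)" unfolding One_nat_def ideal_chain.simps using D(1) by blast
    hence "ideal_chain R (1 + h) (D k) B" using n by (rule ideal_chain_trans)
    thus ?case by auto
  qed
  then obtain n where "ideal_chain R (Suc l) (D n) B" by blast
  hence "ideal_chain R (Suc l) A B" by (rule ideal_chain_antimono[OF _ AB(1) D(2)])
  from l[OF this] show False by simp
qed

text \<open>The point is the explicit index: pairwise distinct terms up to index l + 1 would form
  too long a chain. A single stall does not make the sequence stable; the application propagates it
  by a multiplication.\<close>

lemma ascending_ideals_stall:
  assumes l: "\<And>h. ideal_chain R h A B \<Longrightarrow> h \<le> l"
    and D: "\<And>n. ideal (D n) R" "A \<subseteq> D 0" "\<And>n. D n \<subseteq> B" "\<And>n. D n \<subseteq> D (Suc n)"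
    and AB: "ideal A R" "ideal B R"
  shows "\<exists>i\<le>l. D (Suc i) = D i"
proof (rule ccontr)
  assume "\<not> ?thesis"
  hence s: "D i \<subset> D (Suc i)" if "i \<le> l" for i using that D(4) by blast
  have "i \<le> Suc l \<Longrightarrow> ideal_chain R i A (D i)" for i
  proof (induction i)
    case 0 show ?case using D AB by simp
  next
    case (Suc i)
    hence "ideal_chain R i A (D i)" "D i \<subset> D (Suc i)" using s by simp_all
    thus ?case unfolding ideal_chain.simps using D(1) by blast
  qed
  hence "ideal_chain R (Suc l) A B" by (rule ideal_chain_mono[OF _ AB(2) D(3)]) simp
  from l[OF this] show False by simp
qed

end

section \<open>Almost integral elements\<close>

lemma ideal_pow_0: "ideal_pow R I 0 = carrier R"
  by (simp add: ideals_set_def)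

lemma ideal_pow_Suc_eq: "ideal_pow R I (Suc n) = ideal_prod R (ideal_pow R I n) I"
  by (simp add: ideals_set_def nat_pow_def)

lemma radical_mono: "I \<subseteq> J \<Longrightarrow> radical R I \<subseteq> radical R J"
  by (auto simp: radical_def)

text \<open>For a nonzerodivisor \<open>y\<close>, the powers of the fraction r/y have the common
  denominator y^c, that is, r/y is almost integral over R. With denominators cleared the condition
  also makes sense for zerodivisors.\<close>

definition almost_integral :: "('a, 'b) ring_scheme \<Rightarrow> 'a \<Rightarrow> 'a set" where
  "almost_integral R y =
     {r \<in> carrier R. \<exists>c::nat. \<forall>m::nat. y [^]\<^bsub>R\<^esub> c \<otimes>\<^bsub>R\<^esub> r [^]\<^bsub>R\<^esub> m \<in> PIdl\<^bsub>R\<^esub> (y [^]\<^bsub>R\<^esub> m)}"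

context cring
begin

lemma pow_in_ideal_pow:
  assumes "ideal I R" "x \<in> I"
  shows "x [^] n \<in> ideal_pow R I n"
proof (induction n)
  case 0 show ?case unfolding ideal_pow_0 by simp
next
  case (Suc n)
  thus ?case unfolding ideal_pow_Suc_eq using ideal_prod.prod[of "x [^] n" "ideal_pow R I n" x I R] assms
    by simp
qed

lemma ideal_pow_PIdl_subset:
  assumes "x \<in> carrier R"
  shows "ideal_pow R (PIdl x) n \<subseteq> PIdl (x [^] n)"
proof (induction n)
  case 0
  show ?case unfolding ideal_pow_0 using PIdl_multI[of \<one>] by fastforce
next
  case (Suc n)
  have id: "ideal (PIdl (x [^] Suc n)) R" using assms by (intro cgenideal_ideal) simp
  show ?case
  proof
    fix a assume "a \<in> ideal_pow R (PIdl x) (Suc n)"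
    hence "a \<in> ideal_prod R (ideal_pow R (PIdl x) n) (PIdl x)" by (simp only: ideal_pow_Suc_eq)
    thus "a \<in> PIdl (x [^] Suc n)"
    proof induction
      case (prod i j)
      then obtain b c where bc: "b \<in> carrier R" "i = x [^] n \<otimes> b" "c \<in> carrier R" "j = x \<otimes> c"
        using Suc.IH assms by (auto simp: PIdl_iff subset_eq)
      hence "i \<otimes> j = x [^] Suc n \<otimes> (b \<otimes> c)" using assms by (simp add: m_ac)
      thus ?case using bc assms by (metis PIdl_multI m_closed nat_pow_closed)
    next
      case (sum a b)
      thus ?case using additive_subgroup.a_closed[OF ideal.axioms(1)[OF id]] by blast
    qed
  qed
qed

lemma PIdl_mult_mem:
  assumes "x \<in> carrier R" "y \<in> carrier R" "a \<in> PIdl x" "b \<in> PIdl y"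
  shows "a \<otimes> b \<in> PIdl (x \<otimes> y)"
proof -
  obtain c d where "c \<in> carrier R" "a = x \<otimes> c" "d \<in> carrier R" "b = y \<otimes> d"
    using assms by (auto simp: PIdl_iff)
  hence "a \<otimes> b = (x \<otimes> y) \<otimes> (c \<otimes> d)" "c \<otimes> d \<in> carrier R" using assms by (simp_all add: m_ac)
  thus ?thesis using assms by (metis PIdl_multI m_closed)
qed

lemma ideal_almost_integral:
  assumes y: "y \<in> carrier R"
  shows "ideal (almost_integral R y) R"
proof (rule cring_idealI)
  show "almost_integral R y \<subseteq> carrier R" by (auto simp: almost_integral_def)
  have idl: "ideal (PIdl (y [^] m)) R" for m :: nat using y by (intro cgenideal_ideal) simp
  have z: "\<zero> [^] m \<in> PIdl (y [^] m)" for m :: nat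
    using additive_subgroup.zero_closed[OF ideal.axioms(1)[OF idl]] PIdl_multI[of \<one> \<one>]
    by (cases "m = 0") (auto simp: nat_pow_zero)
  show "\<zero> \<in> almost_integral R y"
    using z by (auto simp: almost_integral_def intro!: exI[of _ 0])
  fix r assume "r \<in> almost_integral R y"
  then obtain c :: nat where r: "r \<in> carrier R" "\<And>m::nat. y [^] c \<otimes> r [^] m \<in> PIdl (y [^] m)"
    by (auto simp: almost_integral_def)
  {
    fix s assume "s \<in> almost_integral R y"
    then obtain d :: nat where s: "s \<in> carrier R" "\<And>m::nat. y [^] d \<otimes> s [^] m \<in> PIdl (y [^] m)"
      by (auto simp: almost_integral_def)
    \<comment> \<open>The two denominators multiply: in a mixed term, y^c serves the power of
      \<open>r\<close> and y^d the power of \<open>s\<close>.\<close>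
    have "y [^] (c + d) \<otimes> (r \<oplus> s) [^] m \<in> PIdl (y [^] m)" for m :: nat
    proof (rule mem_add_pow_closed[OF idl r(1) s(1)])
      fix i j assume ij: "i + j = m"
      have "(y [^] c \<otimes> r [^] i) \<otimes> (y [^] d \<otimes> s [^] j) \<in> PIdl (y [^] i \<otimes> y [^] j)"
        using PIdl_mult_mem[OF _ _ r(2) s(2)] y by simp
      moreover have "y [^] (c + d) \<otimes> r [^] i \<otimes> s [^] j = (y [^] c \<otimes> r [^] i) \<otimes> (y [^] d \<otimes> s [^] j)"
        using y r(1) s(1) by (simp add: nat_pow_mult[symmetric] m_ac)
      ultimately show "y [^] (c + d) \<otimes> r [^] i \<otimes> s [^] j \<in> PIdl (y [^] m)"
        using y ij by (simp add: nat_pow_mult)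
    qed (use y in simp)
    thus "r \<oplus> s \<in> almost_integral R y" using r s by (auto simp: almost_integral_def)
  }
  {
    fix a assume a: "a \<in> carrier R"
    have "y [^] c \<otimes> (a \<otimes> r) [^] m \<in> PIdl (y [^] m)" for m :: nat
    proof -
      have "y [^] c \<otimes> (a \<otimes> r) [^] m = a [^] m \<otimes> (y [^] c \<otimes> r [^] m)"
        using a r y by (simp add: nat_pow_distrib m_ac)
      thus ?thesis using ideal.I_l_closed[OF idl r(2)] a by simp
    qed
    thus "a \<otimes> r \<in> almost_integral R y" using r a by (auto simp: almost_integral_def)
  }
qed

text \<open>The degree n of the integral equation serves as the exponent \<open>c\<close>. For m
  \<le> n the divisibility is immediate; for larger m the equation replaces r^n, and its i-th term
  receives y^i from the coefficient and y^(m-i) from the induction hypothesis.\<close>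

lemma integral_closure_PIdl_subset:
  assumes y: "y \<in> carrier R"
  shows "ideal_integral_closure R (PIdl y) \<subseteq> almost_integral R y"
proof
  fix r assume "r \<in> ideal_integral_closure R (PIdl y)"
  then obtain n :: nat and a where r: "r \<in> carrier R" and n: "n \<ge> 1"
    and a: "\<forall>i\<in>{1..n}. a i \<in> ideal_pow R (PIdl y) i"
    and eq: "r [^] n \<oplus> (\<Oplus>i\<in>{1..n}. a i \<otimes> r [^] (n - i)) = \<zero>"
    by (auto simp: ideal_integral_closure_def)
  have idl: "ideal (PIdl (y [^] m)) R" for m :: nat using y by (intro cgenideal_ideal) simp
  have aP: "a i \<in> PIdl (y [^] i)" if "i \<in> {1..n}" for i
    using a that ideal_pow_PIdl_subset[OF y, of i] by auto
  have ac: "a i \<in> carrier R" if "i \<in> {1..n}" for i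
    using aP[OF that] ideal_carrier[OF idl] by blast
  let ?s = "\<Oplus>i\<in>{1..n}. a i \<otimes> r [^] (n - i)"
  have sc: "?s \<in> carrier R" using ac r by (intro finsum_closed) auto
  have rn: "r [^] n = \<ominus> ?s" using eq r sc by (simp add: minus_equality)
  have "y [^] n \<otimes> r [^] m \<in> PIdl (y [^] m)" for m :: nat
  proof (induction m rule: less_induct)
    case (less m)
    interpret I: ideal "PIdl (y [^] m)" R by (rule idl)
    show ?case
    proof (cases "m \<le> n")
      case True
      hence "y [^] n \<otimes> r [^] m = y [^] m \<otimes> (y [^] (n - m) \<otimes> r [^] m)"
        using y r by (simp add: m_assoc[symmetric] nat_pow_mult)
      thus ?thesis using y r by (simp add: PIdl_multI)
    next
      case False
      define k where "k = m - n"
      have m: "m = n + k" using False by (simp add: k_def)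
      have t: "y [^] n \<otimes> (a i \<otimes> r [^] (n - i) \<otimes> r [^] k) \<in> PIdl (y [^] m)" if i: "i \<in> {1..n}" for i
      proof -
        have "y [^] n \<otimes> r [^] (m - i) \<in> PIdl (y [^] (m - i))"
          using less.IH[of "m - i"] i m n by auto
        hence "a i \<otimes> (y [^] n \<otimes> r [^] (m - i)) \<in> PIdl (y [^] i \<otimes> y [^] (m - i))"
          using PIdl_mult_mem[OF _ _ aP[OF i]] y by simp
        moreover have "y [^] i \<otimes> y [^] (m - i) = y [^] m" "r [^] (n - i) \<otimes> r [^] k = r [^] (m - i)"
          using i m y r by (auto simp: nat_pow_mult)
        moreover have "y [^] n \<otimes> (a i \<otimes> r [^] (n - i) \<otimes> r [^] k) =
            a i \<otimes> (y [^] n \<otimes> (r [^] (n - i) \<otimes> r [^] k))"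
          using y r m_lcomm[of "y [^] n" "a i" "r [^] (n - i) \<otimes> r [^] k"]
          by (simp add: m_assoc ac[OF i])
        ultimately show ?thesis by simp
      qed
      have "r [^] m = r [^] k \<otimes> r [^] n" unfolding m using r by (simp add: nat_pow_mult add.commute)
      hence "y [^] n \<otimes> r [^] m = (y [^] n \<otimes> r [^] k) \<otimes> r [^] n"
        using y r by (simp add: m_assoc)
      also have "\<dots> = \<ominus> ((y [^] n \<otimes> r [^] k) \<otimes> ?s)" using y r sc by (simp add: rn r_minus)
      also have "(y [^] n \<otimes> r [^] k) \<otimes> ?s =
          (\<Oplus>i\<in>{1..n}. (y [^] n \<otimes> r [^] k) \<otimes> (a i \<otimes> r [^] (n - i)))"
        using y r ac by (intro finsum_rdistr) auto
      also have "\<dots> = (\<Oplus>i\<in>{1..n}. y [^] n \<otimes> (a i \<otimes> r [^] (n - i) \<otimes> r [^] k))"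
        using y r ac by (intro finsum_cong') (auto simp: m_ac)
      finally have *: "y [^] n \<otimes> r [^] m = \<ominus> (\<Oplus>i\<in>{1..n}. y [^] n \<otimes> (a i \<otimes> r [^] (n - i) \<otimes> r [^] k))" .
      have "(\<Oplus>i\<in>A. y [^] n \<otimes> (a i \<otimes> r [^] (n - i) \<otimes> r [^] k)) \<in> PIdl (y [^] m)"
        if "finite A" "A \<subseteq> {1..n}" for A
        using that
      proof (induction A)
        case empty thus ?case by simp
      next
        case (insert i A)
        have "y [^] n \<otimes> (a j \<otimes> r [^] (n - j) \<otimes> r [^] k) \<in> carrier R" if "j \<in> insert i A" for j
          using insert.prems y r ac that by auto
        thus ?case using insert t by (subst finsum_insert) (auto intro!: I.a_closed)
      qed
      thus ?thesis unfolding * by (intro I.a_inv_closed) simp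
    qed
  qed
  thus "r \<in> almost_integral R y" using r by (auto simp: almost_integral_def)
qed

section \<open>Almost integrality over the powers of a fixed element\<close>

lemma almost_integral_powD:
  assumes "x \<in> carrier R" "r \<in> almost_integral R (x [^] (n::nat))"
  shows "\<exists>c::nat. \<forall>m::nat. x [^] c \<otimes> r [^] m \<in> PIdl (x [^] (n * m))"
  using assms by (auto simp: almost_integral_def nat_pow_pow)

text \<open>The denominator may be a power of \<open>x\<close> instead of x^n: for n \<ge> 1,
  x^(n*c) is a multiple of x^c. For n = 0 every element qualifies.\<close>

lemma almost_integral_powI:
  assumes x: "x \<in> carrier R" and r: "r \<in> carrier R"
    and c: "\<And>m::nat. x [^] (c::nat) \<otimes> r [^] m \<in> PIdl (x [^] (n * m))"
  shows "r \<in> almost_integral R (x [^] (n::nat))"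
proof (cases "n = 0")
  case True
  have "r [^] m \<in> PIdl \<one>" for m :: nat using PIdl_multI[of \<one> "r [^] m"] r by simp
  thus ?thesis using r True by (auto simp: almost_integral_def)
next
  case False
  have "x [^] (n * c) \<otimes> r [^] m \<in> PIdl (x [^] (n * m))" for m :: nat
  proof -
    interpret I: ideal "PIdl (x [^] (n * m))" R using x by (intro cgenideal_ideal) simp
    have "c + (n * c - c) = n * c" using False by (simp add: add_diff_inverse_nat)
    hence "x [^] (n * c) = x [^] (n * c - c) \<otimes> x [^] c" using x by (simp add: nat_pow_mult add.commute)
    hence "x [^] (n * c) \<otimes> r [^] m = x [^] (n * c - c) \<otimes> (x [^] c \<otimes> r [^] m)"
      using x r by (simp add: m_assoc)
    thus ?thesis using c[of m] x by (simp add: I.I_l_closed)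
  qed
  thus ?thesis using x r by (auto simp: almost_integral_def nat_pow_pow)
qed

lemma almost_integral_pow_antimono:
  assumes "x \<in> carrier R" "i \<le> (j::nat)"
  shows "almost_integral R (x [^] j) \<subseteq> almost_integral R (x [^] i)"
proof
  fix r assume r: "r \<in> almost_integral R (x [^] j)"
  then obtain c :: nat where c: "\<And>m::nat. x [^] c \<otimes> r [^] m \<in> PIdl (x [^] (j * m))"
    using almost_integral_powD[OF assms(1)] by blast
  have "x [^] c \<otimes> r [^] m \<in> PIdl (x [^] (i * m))" for m :: nat
    using PIdl_pow_mono[OF assms(1) mult_le_mono1[OF assms(2)]] c by blast
  thus "r \<in> almost_integral R (x [^] i)"
    using r by (intro almost_integral_powI[OF assms(1)]) (auto simp: almost_integral_def)
qed

end

section \<open>Noetherian local rings\<close>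

lemma (in noetherian_ring) maximal_element_exists:
  assumes "I\<^sub>0 \<in> S" "\<And>I. I \<in> S \<Longrightarrow> ideal I R"
  shows "\<exists>I\<in>S. \<forall>J\<in>S. I \<subseteq> J \<longrightarrow> J = I"
proof (rule subset_Zorn_nonempty)
  show "S \<noteq> {}" using assms(1) by blast
  fix C assume C: "C \<noteq> {}" "subset.chain S C"
  hence "subset.chain {I. ideal I R} C" using assms(2) by (auto simp: subset_chain_def)
  thus "\<Union>C \<in> S" using ideal_chain_is_trivial[OF C(1)] C(2) by (auto simp: subset_chain_def)
qed

context noetherian_local_ring
begin

lemma unit_if_notin_M:
  assumes "r \<in> carrier R" "r \<notin> M"
  shows "\<exists>s\<in>carrier R. r \<otimes> s = \<one>"
proof (rule ccontr)
  assume *: "\<not> ?thesis"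
  note idl = cgenideal_ideal[OF assms(1)]
  let ?S = "{I. ideal I R \<and> PIdl r \<subseteq> I \<and> I \<noteq> carrier R}"
  have "\<one> \<notin> PIdl r" using * assms(1) by (auto simp: PIdl_iff)
  hence "PIdl r \<in> ?S" using idl one_closed by auto
  hence "\<exists>I\<in>?S. \<forall>J\<in>?S. I \<subseteq> J \<longrightarrow> J = I" by (rule maximal_element_exists) simp
  then obtain I where "I \<in> ?S" and max: "\<forall>J\<in>?S. I \<subseteq> J \<longrightarrow> J = I" by (rule bexE)
  hence I: "ideal I R" "PIdl r \<subseteq> I" "I \<noteq> carrier R" by simp_all
  have "maximalideal I R"
  proof (rule maximalidealI[OF I(1)])
    fix J assume "ideal J R" "I \<subseteq> J" "J \<subseteq> carrier R"
    thus "J = I \<or> J = carrier R" using bspec[OF max, of J] I(2) by simp blast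
  qed (use I(3) in simp)
  hence "I = M" by (rule unique_maximal)
  thus False using I(2) assms cgenideal_self[OF assms(1)] by blast
qed

lemma ideal_M: "ideal M R" by (rule is_ideal)

text \<open>Choose \<open>a\<close> outside \<open>I\<close> with (I : a) maximal. If a*m were
  outside \<open>I\<close>, maximality would give (I : a) = (I : a*m^k) inductively, so no a*m^k
  would lie in \<open>I\<close>, although some m^k does.\<close>

lemma socle_element_exists:
  assumes I: "ideal I R" "I \<noteq> carrier R" and rad: "M \<subseteq> radical R I"
  shows "\<exists>a\<in>carrier R. a \<notin> I \<and> (\<forall>m\<in>M. a \<otimes> m \<in> I)"
proof -
  let ?C = "\<lambda>a. {r \<in> carrier R. a \<otimes> r \<in> I}"
  let ?S = "?C ` (carrier R - I)"
  obtain b where "b \<in> carrier R - I" using I ideal_carrier[OF I(1)] by blast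
  hence "?C b \<in> ?S" by (rule imageI)
  moreover have "ideal J R" if "J \<in> ?S" for J using that ideal_vimage_mult[OF I(1)] by blast
  ultimately have "\<exists>J\<in>?S. \<forall>K\<in>?S. J \<subseteq> K \<longrightarrow> K = J" by (rule maximal_element_exists)
  then obtain J where J: "J \<in> ?S" and max: "\<forall>K\<in>?S. J \<subseteq> K \<longrightarrow> K = J" by (rule bexE)
  then obtain a where a: "a \<in> carrier R" "a \<notin> I" "J = ?C a" by blast
  have "a \<otimes> m \<in> I" if m: "m \<in> M" for m
  proof (rule ccontr)
    assume am: "a \<otimes> m \<notin> I"
    have mc: "m \<in> carrier R" using m Icarr by blast
    have *: "a \<otimes> m [^] k \<notin> I" for k :: nat
    proof (induction k)
      case 0 show ?case using a by simp
    next
      case (Suc k)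
      have "?C a \<subseteq> ?C (a \<otimes> m [^] k)"
      proof
        fix r assume r: "r \<in> ?C a"
        have "a \<otimes> m [^] k \<otimes> r = m [^] k \<otimes> (a \<otimes> r)" using a mc r by (simp add: m_ac)
        thus "r \<in> ?C (a \<otimes> m [^] k)" using r mc ideal.I_l_closed[OF I(1)] by simp
      qed
      moreover have "?C (a \<otimes> m [^] k) \<in> ?S" using a Suc mc by (intro imageI) simp
      ultimately have "?C (a \<otimes> m [^] k) = ?C a" using max a(3) by blast
      hence "a \<otimes> m [^] k \<otimes> m \<notin> I" using am mc by blast
      thus ?case using a mc by (simp add: m_assoc)
    qed
    obtain k :: nat where "m [^] k \<in> I" using rad m by (auto simp: radical_def)
    thus False using *[of k] ideal.I_l_closed[OF I(1)] a by blast
  qed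
  thus ?thesis using a by blast
qed

text \<open>Noetherian induction from above: a maximal counterexample is proper, hence has a socle
  element \<open>a\<close>, and adjoining \<open>a\<close> gives a larger ideal whose radical still
  contains \<open>M\<close>.\<close>

lemma primary_ideal_induct [consumes 2, case_names carrier socle]:
  assumes I: "ideal I R" "M \<subseteq> radical R I"
    and carrier: "P (carrier R)"
    and socle: "\<And>I a. ideal I R \<Longrightarrow> a \<in> carrier R \<Longrightarrow> a \<notin> I \<Longrightarrow> (\<And>m. m \<in> M \<Longrightarrow> a \<otimes> m \<in> I) \<Longrightarrow>
      P (I <+>\<^bsub>R\<^esub> PIdl a) \<Longrightarrow> P I"
  shows "P I"
proof (rule ccontr)
  assume nP: "\<not> P I"
  let ?S = "{I. ideal I R \<and> M \<subseteq> radical R I \<and> \<not> P I}"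
  have "I \<in> ?S" using I nP by simp
  hence "\<exists>J\<in>?S. \<forall>K\<in>?S. J \<subseteq> K \<longrightarrow> K = J" by (rule maximal_element_exists) simp
  then obtain J where J: "J \<in> ?S" and max: "\<forall>K\<in>?S. J \<subseteq> K \<longrightarrow> K = J" by (rule bexE)
  have Ji: "ideal J R" "M \<subseteq> radical R J" using J by auto
  moreover have "J \<noteq> carrier R" using J carrier by auto
  ultimately obtain a where a: "a \<in> carrier R" "a \<notin> J" "\<And>m. m \<in> M \<Longrightarrow> a \<otimes> m \<in> J"
    using socle_element_exists by blast
  note P = cgenideal_ideal[OF a(1)]
  let ?K = "J <+>\<^bsub>R\<^esub> PIdl a"
  have K: "ideal ?K R" "J \<subseteq> ?K" "a \<in> ?K"
    using add_ideals[OF Ji(1) P] subset_add_ideals1[OF Ji(1) P] subset_add_ideals2[OF Ji(1) P]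
      cgenideal_self[OF a(1)] by auto
  hence "M \<subseteq> radical R ?K" using Ji(2) radical_mono[OF K(2)] by blast
  hence "P ?K" using bspec[OF max, of ?K] K a(2) by auto
  hence "P J" using socle[OF Ji(1) a(1,2)] a(3) by blast
  thus False using J by simp
qed

text \<open>Adjoining a socle element raises the length by at most one: if i + a*r lies outside
  \<open>I\<close>, then r lies outside \<open>M\<close>, so r is a unit and \<open>a\<close> is
  recovered.\<close>

lemma finite_colength:
  assumes "ideal I R" "M \<subseteq> radical R I"
  shows "\<exists>l. \<forall>h. ideal_chain R h I (carrier R) \<longrightarrow> h \<le> l"
  using assms
proof (induction rule: primary_ideal_induct)
  case carrier
  have "h = 0" if ch: "ideal_chain R h (carrier R) (carrier R)" for h
  proof (cases h)
    case (Suc k)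
    then obtain C where "ideal_chain R k (carrier R) C" "C \<subset> carrier R" using ch by auto
    thus ?thesis using ideal_chainD[of k "carrier R" C] by blast
  qed simp
  thus ?case by blast
next
  case (socle I a)
  note P = cgenideal_ideal[OF socle(2)]
  let ?K = "I <+>\<^bsub>R\<^esub> PIdl a"
  obtain l where l: "\<And>h. ideal_chain R h ?K (carrier R) \<Longrightarrow> h \<le> l" using socle(5) by blast
  have K: "ideal ?K R" "I \<subseteq> ?K" using add_ideals[OF socle(1) P] subset_add_ideals1[OF socle(1) P] by auto
  have p1: "p \<le> 1" if p: "ideal_chain R p I ?K" for p
  proof (rule ccontr)
    assume "\<not> p \<le> 1"
    then obtain k where "p = Suc (Suc k)" by (metis One_nat_def Suc_leI less_one not_le not0_implies_Suc Suc_le_mono le0)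
    then obtain C D where CD: "ideal_chain R k I C" "C \<subset> D" "D \<subset> ?K" "ideal D R"
      using p by auto
    interpret D: ideal D R by (rule CD(4))
    have ID: "I \<subseteq> D" using ideal_chainD[OF CD(1)] CD(2) by blast
    obtain d where d: "d \<in> D" "d \<notin> I" using CD(2) ideal_chainD[OF CD(1)] by blast
    hence "d \<in> ?K" using CD(3) by blast
    then obtain i b where ib: "i \<in> I" "b \<in> PIdl a" "d = i \<oplus> b"
      unfolding mem_add_ideals_iff by blast
    then obtain r where r: "r \<in> carrier R" "b = a \<otimes> r" using socle(2) by (auto simp: PIdl_iff)
    have "b \<notin> I" using ib d(2) additive_subgroup.a_closed[OF ideal.axioms(1)[OF socle(1)]] by blast
    hence "r \<notin> M" using socle(4) r by blast
    then obtain s where s: "s \<in> carrier R" "r \<otimes> s = \<one>" using unit_if_notin_M r by blast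
    have "i \<in> D" using ib ID by blast
    moreover have "b = \<ominus> i \<oplus> d" using ib r socle(2) ideal.Icarr[OF socle(1)] by (simp add: r_neg1)
    ultimately have "b \<in> D" using d by (simp add: D.a_closed D.a_inv_closed)
    hence "b \<otimes> s \<in> D" using s by (simp add: D.I_r_closed)
    moreover have "b \<otimes> s = a" using r s socle(2) by (simp add: m_assoc)
    ultimately have "PIdl a \<subseteq> D" using cgenideal_minimal[OF CD(4)] by simp
    hence "?K \<subseteq> D" using add_ideals_least[OF CD(4) ID] by blast
    thus False using CD(3) by blast
  qed
  have "h \<le> Suc l" if h: "ideal_chain R h I (carrier R)" for h
  proof -
    obtain p q where "h \<le> p + q" "ideal_chain R p I ?K" "ideal_chain R q ?K (carrier R)"
      using ideal_chain_split_between[OF h K ideal_carrier[OF K(1)]] .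
    thus ?thesis using p1[of p] l[of q] by linarith
  qed
  thus ?case by blast
qed

text \<open>Each socle element costs one factor \<open>M\<close>, which carries I + aR into
  \<open>I\<close>.\<close>

lemma ideal_pow_M_subset:
  assumes "ideal I R" "M \<subseteq> radical R I"
  shows "\<exists>k. ideal_pow R M k \<subseteq> I"
  using assms
proof (induction rule: primary_ideal_induct)
  case carrier
  have "ideal_pow R M 0 \<subseteq> carrier R" by (simp only: ideal_pow_0)
  thus ?case ..
next
  case (socle I a)
  interpret I: ideal I R by (rule socle(1))
  obtain k where k: "ideal_pow R M k \<subseteq> I <+>\<^bsub>R\<^esub> PIdl a" using socle by blast
  have "ideal_pow R M (Suc k) \<subseteq> I"
  proof
    fix b assume "b \<in> ideal_pow R M (Suc k)"
    hence "b \<in> ideal_prod R (ideal_pow R M k) M" by (simp only: ideal_pow_Suc_eq)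
    thus "b \<in> I"
    proof induction
      case (prod i j)
      have "i \<in> I <+>\<^bsub>R\<^esub> PIdl a" using prod(1) k by blast
      then obtain c d where cd: "c \<in> I" "d \<in> PIdl a" "i = c \<oplus> d" unfolding mem_add_ideals_iff by blast
      then obtain r where r: "r \<in> carrier R" "d = a \<otimes> r" using PIdl_iff[OF socle(2)] by blast
      have j: "j \<in> carrier R" using prod(2) Icarr by blast
      have "i \<otimes> j = c \<otimes> j \<oplus> r \<otimes> (a \<otimes> j)"
        using r j socle(2) I.Icarr[OF cd(1)] m_lcomm[of r a j] by (simp add: cd(3) l_distr m_assoc)
      thus ?case using cd(1) j r socle(4)[OF prod(2)] by (simp add: I.I_r_closed I.I_l_closed)
    qed (rule I.a_closed)
  qed
  thus ?case ..
qed

text \<open>The annihilators of the powers of \<open>x\<close> ascend, and \<open>N\<close> is an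
  index at which they are maximal.\<close>

lemma pow_torsion_bound:
  assumes x: "x \<in> carrier R"
  shows "\<exists>N::nat. \<forall>j::nat. \<forall>t\<in>carrier R. x [^] j \<otimes> t = \<zero> \<longrightarrow> x [^] N \<otimes> t = \<zero>"
proof -
  let ?A = "\<lambda>j::nat. {t \<in> carrier R. x [^] j \<otimes> t \<in> {\<zero>}}"
  have "?A 0 \<in> range ?A" by (rule rangeI)
  moreover have "ideal I R" if "I \<in> range ?A" for I
  proof -
    from that obtain j where "I = ?A j" by (rule rangeE)
    thus ?thesis using ideal_vimage_mult[OF zeroideal, of "x [^] j"] x by simp
  qed
  ultimately have "\<exists>I\<in>range ?A. \<forall>J\<in>range ?A. I \<subseteq> J \<longrightarrow> J = I" by (rule maximal_element_exists)
  then obtain N where N: "\<forall>J\<in>range ?A. ?A N \<subseteq> J \<longrightarrow> J = ?A N" by (elim bexE rangeE) simp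
  have mono: "?A i \<subseteq> ?A (i + k)" for i k
  proof
    fix t assume t: "t \<in> ?A i"
    have "x [^] (i + k) = x [^] k \<otimes> x [^] i" using x by (simp add: nat_pow_mult add.commute)
    hence "x [^] (i + k) \<otimes> t = x [^] k \<otimes> (x [^] i \<otimes> t)" using x t by (simp add: m_assoc)
    thus "t \<in> ?A (i + k)" using x t by simp
  qed
  have "x [^] N \<otimes> t = \<zero>" if t: "t \<in> carrier R" "x [^] j \<otimes> t = \<zero>" for j :: nat and t
  proof -
    have "?A (N + j) = ?A N" using N mono[of N j] by blast
    moreover have "t \<in> ?A (N + j)" using mono[of j N] t by (simp add: add.commute subset_eq)
    ultimately have "t \<in> ?A N" by blast
    thus ?thesis by simp
  qed
  thus ?thesis by blast
qed

end

section \<open>Powers of a parameter\<close>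

text \<open>Collects two constants attached to \<open>x\<close>: beyond x^N there is no new torsion,
  so \<open>x\<close> is injective on x^N R, and \<open>e\<close> bounds the length of R/xR.\<close>

locale bounded_parameter = noetherian_local_ring R M
  for R :: "('a, 'b) ring_scheme" (structure) and M +
  fixes x :: 'a and N e :: nat
  assumes x_in_M: "x \<in> M"
    and M_subset_radical: "M \<subseteq> radical R (PIdl x)"
    and torsion: "t \<in> carrier R \<Longrightarrow> x [^] (j::nat) \<otimes> t = \<zero> \<Longrightarrow> x [^] N \<otimes> t = \<zero>"
    and colength: "ideal_chain R h (PIdl x) (carrier R) \<Longrightarrow> h \<le> e"
begin

section \<open>Cancellation of powers of \<open>x\<close> and the degree bound\<close>

lemma x_closed [simp, intro]: "x \<in> carrier R"
  using x_in_M Icarr by blast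

text \<open>Stands in for \<open>x\<close> being a nonzerodivisor: cancelling any power of
  \<open>x\<close> costs the same factor x^N.\<close>

lemma pow_cancel:
  assumes "a \<in> carrier R" "b \<in> carrier R" "x [^] (j::nat) \<otimes> a = x [^] j \<otimes> b"
  shows "x [^] N \<otimes> a = x [^] N \<otimes> b"
proof -
  have *: "x [^] i \<otimes> (a \<ominus> b) = x [^] i \<otimes> a \<ominus> x [^] i \<otimes> b" for i :: nat
    using assms by (simp add: a_minus_def r_distr r_minus)
  have "x [^] j \<otimes> (a \<ominus> b) = \<zero>" using assms unfolding * by (simp add: a_minus_def r_neg)
  hence "x [^] N \<otimes> (a \<ominus> b) = \<zero>" using assms by (intro torsion) auto
  thus ?thesis unfolding * using assms by simp
qed

lemma M_subset_radical_PIdl_pow: "M \<subseteq> radical R (PIdl (x [^] (k::nat)))"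
proof
  fix m assume m: "m \<in> M"
  hence mc: "m \<in> carrier R" using Icarr by blast
  obtain i :: nat where "m [^] i \<in> PIdl x" using m M_subset_radical by (auto simp: radical_def)
  then obtain s where s: "s \<in> carrier R" "m [^] i = x \<otimes> s" by (auto simp: PIdl_iff)
  have "m [^] (i * k) = x [^] k \<otimes> s [^] k"
    using s mc by (simp add: nat_pow_pow[symmetric] nat_pow_distrib)
  thus "m \<in> radical R (PIdl (x [^] k))"
    using s mc by (auto simp: radical_def intro!: exI[of _ "i * k"] PIdl_multI)
qed

text \<open>The ring \<open>S = R[r/x^n]\<close> is represented by the ideal \<open>I = x^(c+N) S\<close>, generated by
  \<open>u m = x^(c+N) (r/x^n)^m\<close>; it lies in \<open>x^N R\<close>, where multiplication by \<open>x\<close> is injective.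
  Since \<open>I/xI\<close> has length at most \<open>e\<close>, the element \<open>r/x^n\<close> has degree at most \<open>e + 1\<close> over \<open>R\<close>.\<close>

lemma almost_integral_degree_bound:
  assumes r: "r \<in> almost_integral R (x [^] (n::nat))"
  shows "x [^] N \<otimes> r [^] Suc e \<in> PIdl (x [^] (N + n))"
proof -
  have rc [simp]: "r \<in> carrier R" using r by (simp add: almost_integral_def)
  obtain c :: nat where "\<forall>m::nat. x [^] c \<otimes> r [^] m \<in> PIdl (x [^] (n * m))"
    using almost_integral_powD[OF x_closed r] by blast
  hence "\<forall>m::nat. \<exists>v\<in>carrier R. x [^] c \<otimes> r [^] m = x [^] (n * m) \<otimes> v" by (simp add: PIdl_iff)
  then obtain v where v_all: "\<forall>m::nat. v m \<in> carrier R \<and> x [^] c \<otimes> r [^] m = x [^] (n * m) \<otimes> v m"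
    by metis
  hence v [simp]: "v m \<in> carrier R" and v_eq: "x [^] c \<otimes> r [^] m = x [^] (n * m) \<otimes> v m" for m
    by auto
  \<comment> \<open>\<open>v m\<close> stands for x^c (r/x^n)^m but is determined only up to
    torsion. The factor x^N removes the ambiguity, which yields the recursion
    \<open>u_Suc\<close>.\<close>
  define u where "u = (\<lambda>m. x [^] N \<otimes> v m)"
  have u [simp]: "u m \<in> carrier R" for m by (simp add: u_def)
  have u_eq: "x [^] (n * m) \<otimes> u m = x [^] (c + N) \<otimes> r [^] m" for m
  proof -
    have "x [^] (n * m) \<otimes> u m = x [^] N \<otimes> (x [^] (n * m) \<otimes> v m)" by (simp add: u_def m_lcomm)
    also have "\<dots> = x [^] N \<otimes> (x [^] c \<otimes> r [^] m)" by (simp only: v_eq)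
    also have "\<dots> = x [^] (c + N) \<otimes> r [^] m" by (simp add: m_assoc[symmetric] nat_pow_mult add.commute)
    finally show ?thesis .
  qed
  have u_Suc: "x [^] n \<otimes> u (Suc m) = r \<otimes> u m" for m
  proof -
    have "x [^] (n * m) \<otimes> (x [^] n \<otimes> v (Suc m)) = x [^] (n * Suc m) \<otimes> v (Suc m)"
      by (simp add: m_assoc[symmetric] nat_pow_mult add.commute)
    also have "\<dots> = r \<otimes> (x [^] c \<otimes> r [^] m)" by (simp only: v_eq[symmetric]) (simp add: m_ac)
    also have "\<dots> = x [^] (n * m) \<otimes> (r \<otimes> v m)" by (simp only: v_eq) (simp add: m_lcomm)
    finally have "x [^] N \<otimes> (x [^] n \<otimes> v (Suc m)) = x [^] N \<otimes> (r \<otimes> v m)"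
      by (intro pow_cancel) simp_all
    thus ?thesis by (simp add: u_def m_lcomm)
  qed
  have u_0: "u 0 = x [^] (c + N)" using u_eq[of 0] by simp
  define I where "I = Idl (range u)"
  \<comment> \<open>\<open>J i\<close> represents the polynomials of degree at most \<open>i\<close>
    in r/x^n, scaled by x^(c+N).\<close>
  define J where "J = (\<lambda>i. Idl (u ` {..i}))"
  have I: "ideal I R" unfolding I_def by (rule genideal_ideal) auto
  interpret I: ideal I R by (rule I)
  have J: "ideal (J i) R" for i unfolding J_def by (rule genideal_ideal) auto
  have uI: "u m \<in> I" for m unfolding I_def by (rule genideal_self[THEN subsetD]) auto
  have uJ: "u m \<in> J i" if "m \<le> i" for m i
    unfolding J_def by (rule genideal_self[THEN subsetD]) (use that in auto)
  have J_least: "J i \<subseteq> A" if "ideal A R" "\<And>m. m \<le> i \<Longrightarrow> u m \<in> A" for A i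
    unfolding J_def using that by (intro genideal_minimal) auto
  have I_least: "I \<subseteq> A" if "ideal A R" "\<And>m. u m \<in> A" for A
    unfolding I_def using that by (intro genideal_minimal) auto
  have JI: "J i \<subseteq> I" for i using J_least[OF I] uI by blast
  have J_mono: "J i \<subseteq> J k" if "i \<le> k" for i k using J_least[OF J] uJ that by (meson le_trans)
  have I_cancel: "a = b" if "a \<in> I" "b \<in> I" "x [^] k \<otimes> a = x [^] k \<otimes> b" for a b and k :: nat
  proof -
    have "I \<subseteq> PIdl (x [^] N)"
      by (rule I_least) (auto simp: u_def intro!: cgenideal_ideal PIdl_multI)
    then obtain a' b' where ab: "a' \<in> carrier R" "a = x [^] N \<otimes> a'" "b' \<in> carrier R" "b = x [^] N \<otimes> b'"
      using \<open>a \<in> I\<close> \<open>b \<in> I\<close> PIdl_iff[of "x [^] N"] by (meson nat_pow_closed subsetD x_closed)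
    have "x [^] (k + N) \<otimes> a' = x [^] (k + N) \<otimes> b'"
      using that(3) ab by (simp add: m_assoc[symmetric] nat_pow_mult)
    thus ?thesis using pow_cancel ab by blast
  qed
  \<comment> \<open>Multiplication by r/x^n without fractions: \<open>g\<close> is the product of
    \<open>f\<close> with r/x^n when x^n g = r f. The \<open>f\<close> admitting such a
    \<open>g\<close> form an ideal, so generators suffice.\<close>
  have shift_ideal: "ideal {f \<in> carrier R. \<exists>g\<in>A. x [^] n \<otimes> g = r \<otimes> f} R" if A: "ideal A R" for A
  proof -
    interpret A: ideal A R by (rule A)
    show ?thesis
    proof (rule cring_idealI, goal_cases)
      case 2 thus ?case by (auto intro!: bexI[of _ \<zero>])
    next
      case (3 a b)
      then obtain g h where "a \<in> carrier R" "b \<in> carrier R" "g \<in> A" "h \<in> A"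
        "x [^] n \<otimes> g = r \<otimes> a" "x [^] n \<otimes> h = r \<otimes> b" by blast
      thus ?case by (auto simp: r_distr A.Icarr intro!: bexI[of _ "g \<oplus> h"])
    next
      case (4 a s)
      then obtain g where "a \<in> carrier R" "g \<in> A" "x [^] n \<otimes> g = r \<otimes> a" by blast
      thus ?case using 4 by (auto simp: m_lcomm[of _ s] A.Icarr A.I_l_closed intro!: bexI[of _ "s \<otimes> g"])
    qed auto
  qed
  have shift_J: "\<exists>g\<in>J (Suc i). x [^] n \<otimes> g = r \<otimes> f" if "f \<in> J i" for f i
  proof -
    have "J i \<subseteq> {f \<in> carrier R. \<exists>g\<in>J (Suc i). x [^] n \<otimes> g = r \<otimes> f}"
    proof (rule J_least[OF shift_ideal[OF J]])
      fix m assume "m \<le> i"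
      hence "u (Suc m) \<in> J (Suc i)" by (intro uJ) simp
      thus "u m \<in> {f \<in> carrier R. \<exists>g\<in>J (Suc i). x [^] n \<otimes> g = r \<otimes> f}" using u_Suc[of m] u[of m] by blast
    qed
    thus ?thesis using that by blast
  qed
  have shift_I: "\<exists>g\<in>I. x [^] n \<otimes> g = r \<otimes> f" if "f \<in> I" for f
  proof -
    have "I \<subseteq> {f \<in> carrier R. \<exists>g\<in>I. x [^] n \<otimes> g = r \<otimes> f}"
    proof (rule I_least[OF shift_ideal[OF I]])
      show "u m \<in> {f \<in> carrier R. \<exists>g\<in>I. x [^] n \<otimes> g = r \<otimes> f}" for m
        using u_Suc[of m] u[of m] uI[of "Suc m"] by blast
    qed
    thus ?thesis using that by blast
  qed
  let ?xI = "(\<otimes>) x ` I"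
  have xI: "ideal ?xI R" by (rule ideal_image_mult[OF I x_closed])
  have xII: "?xI \<subseteq> I" using I.I_l_closed by auto
  define K where "K = (\<lambda>i. ?xI <+>\<^bsub>R\<^esub> J i)"
  have K: "ideal (K i) R" for i unfolding K_def by (rule add_ideals[OF xI J])
  have JK: "J i \<subseteq> K i" for i unfolding K_def by (rule subset_add_ideals2[OF xI J])
  have "PIdl (x [^] (c + N)) \<subseteq> I" using uI[of 0] u_0 by (intro cgenideal_minimal I) simp
  hence "M \<subseteq> radical R I" using radical_mono M_subset_radical_PIdl_pow by blast
  then obtain l where l: "\<And>h. ideal_chain R h I (carrier R) \<Longrightarrow> h \<le> l"
    using finite_colength[OF I] by blast
  \<comment> \<open>All \<open>K i\<close> lie between xI and \<open>I\<close>, and I/xI has length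
    at most \<open>e\<close>. The stall index is thus bounded independently of \<open>n\<close>,
    \<open>c\<close> and \<open>r\<close>.\<close>
  have "\<exists>i\<le>e. K (Suc i) = K i"
  proof (rule ascending_ideals_stall[where A = ?xI and B = I])
    show "h \<le> e" if "ideal_chain R h ?xI I" for h
      using ideal_chain_mult_bound[OF x_closed I colength l that] by blast
    show "?xI \<subseteq> K 0" unfolding K_def by (rule subset_add_ideals1[OF xI J])
    show "K i \<subseteq> I" for i unfolding K_def by (rule add_ideals_least[OF I xII JI])
    show "K i \<subseteq> K (Suc i)" for i unfolding K_def by (intro add_ideals_mono J_mono) auto
  qed (fact K xI I)+
  then obtain i where i: "i \<le> e" "K (Suc i) = K i" by blast
  have uK: "u m \<in> K i" for m
  proof (cases "m \<le> i")
    case True thus ?thesis using uJ JK by blast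
  next
    case False
    hence "Suc i \<le> m" by simp
    thus ?thesis
    proof (induction m rule: dec_induct)
      case base show ?case using uJ[of "Suc i"] JK[of "Suc i"] i(2) by auto
    next
      case (step m)
      \<comment> \<open>Multiplying u m = x d + f by r/x^n raises the degree of the part
        \<open>f\<close> by one only, so the result lies in \<open>K (Suc i)\<close>, which equals
        \<open>K i\<close>.\<close>
      then obtain d f where df: "d \<in> I" "f \<in> J i" "u m = x \<otimes> d \<oplus> f"
        unfolding K_def mem_add_ideals_iff by blast
      obtain d' where d': "d' \<in> I" "x [^] n \<otimes> d' = r \<otimes> d" using shift_I df(1) by blast
      obtain f' where f': "f' \<in> J (Suc i)" "x [^] n \<otimes> f' = r \<otimes> f" using shift_J df(2) by blast
      have [simp]: "d \<in> carrier R" "f \<in> carrier R" "d' \<in> carrier R" "f' \<in> carrier R"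
        using df d' f' I.Icarr JI by blast+
      have "x [^] n \<otimes> (x \<otimes> d' \<oplus> f') = x \<otimes> (x [^] n \<otimes> d') \<oplus> x [^] n \<otimes> f'"
        by (simp add: r_distr m_lcomm)
      also have "\<dots> = r \<otimes> u m" unfolding d'(2) f'(2) df(3) by (simp add: r_distr m_lcomm)
      also have "\<dots> = x [^] n \<otimes> u (Suc m)" by (simp only: u_Suc)
      finally have "x [^] n \<otimes> (x \<otimes> d' \<oplus> f') = x [^] n \<otimes> u (Suc m)" .
      moreover have "x \<otimes> d' \<oplus> f' \<in> I" using d'(1) f'(1) JI by (simp add: I.a_closed I.I_l_closed subset_eq)
      ultimately have "x \<otimes> d' \<oplus> f' = u (Suc m)" using I_cancel uI by blast
      moreover have "x \<otimes> d' \<oplus> f' \<in> K (Suc i)"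
        unfolding K_def mem_add_ideals_iff using d' f' by blast
      ultimately show ?case using i(2) by simp
    qed
  qed
  have IK: "I \<subseteq> K i" by (rule I_least[OF K uK])
  \<comment> \<open>Nakayama by iteration: the inclusion of \<open>I\<close> in xI + J i is
    substituted into itself \<open>k\<close> times.\<close>
  have Nak: "\<exists>b\<in>I. \<exists>f\<in>J i. a = x [^] k \<otimes> b \<oplus> f" if a: "a \<in> I" for a and k :: nat
  proof (induction k)
    case 0
    have "\<zero> \<in> J i" by (rule additive_subgroup.zero_closed[OF ideal.axioms(1)[OF J]])
    moreover have "a = x [^] (0::nat) \<otimes> a \<oplus> \<zero>" using I.Icarr[OF a] by simp
    ultimately show ?case using a by blast
  next
    case (Suc k)
    then obtain b f where bf: "b \<in> I" "f \<in> J i" "a = x [^] k \<otimes> b \<oplus> f" by blast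
    have "b \<in> K i" using bf(1) IK by blast
    then obtain d g where dg: "d \<in> I" "g \<in> J i" "b = x \<otimes> d \<oplus> g"
      unfolding K_def mem_add_ideals_iff by blast
    interpret J: ideal "J i" R by (rule J)
    have [simp]: "d \<in> carrier R" "f \<in> carrier R" "g \<in> carrier R"
      using bf dg I.Icarr J.Icarr by blast+
    have "a = x [^] Suc k \<otimes> d \<oplus> (x [^] k \<otimes> g \<oplus> f)"
      unfolding bf(3) dg(3) by (simp add: r_distr m_assoc a_assoc)
    moreover have "x [^] k \<otimes> g \<oplus> f \<in> J i" using bf dg by (simp add: J.I_l_closed J.a_closed)
    ultimately show ?case using dg(1) by blast
  qed
  \<comment> \<open>With k = c + N the remainder x^k b is a multiple of u 0 and hence lies in
    \<open>J i\<close>, so finitely many substitutions suffice.\<close>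
  have "u (Suc e) \<in> J i"
  proof -
    interpret J: ideal "J i" R by (rule J)
    obtain b f where bf: "b \<in> I" "f \<in> J i" "u (Suc e) = x [^] (c + N) \<otimes> b \<oplus> f"
      using Nak[OF uI] by blast
    have "u 0 \<otimes> b \<in> J i" using uJ[of 0 i] I.Icarr[OF bf(1)] by (simp add: J.I_r_closed)
    thus ?thesis unfolding bf(3) u_0[symmetric] using bf(2) by (simp add: J.a_closed)
  qed
  \<comment> \<open>Since i \<le> e, the factor x^(n*e) clears the denominators of all generators of
    \<open>J i\<close> at once.\<close>
  moreover have "J i \<subseteq> {b \<in> carrier R. x [^] (n * e) \<otimes> b \<in> PIdl (x [^] (c + N))}"
  proof (rule J_least)
    show "ideal {b \<in> carrier R. x [^] (n * e) \<otimes> b \<in> PIdl (x [^] (c + N))} R"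
      by (intro ideal_vimage_mult cgenideal_ideal) simp_all
    fix m assume "m \<le> i"
    hence "n * e = n * (e - m) + n * m" using i(1) by (simp add: distrib_left[symmetric])
    hence "x [^] (n * e) \<otimes> u m = x [^] (n * (e - m)) \<otimes> (x [^] (n * m) \<otimes> u m)"
      by (simp add: m_assoc[symmetric] nat_pow_mult)
    also have "\<dots> = x [^] (c + N) \<otimes> (x [^] (n * (e - m)) \<otimes> r [^] m)" by (simp add: u_eq m_lcomm)
    finally show "u m \<in> {b \<in> carrier R. x [^] (n * e) \<otimes> b \<in> PIdl (x [^] (c + N))}"
      by (simp add: PIdl_multI)
  qed
  ultimately have "x [^] (n * e) \<otimes> u (Suc e) \<in> PIdl (x [^] (c + N))" by blast
  then obtain b where b: "b \<in> carrier R" "x [^] (n * e) \<otimes> u (Suc e) = x [^] (c + N) \<otimes> b"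
    by (auto simp: PIdl_iff)
  have "x [^] (c + N) \<otimes> r [^] Suc e = x [^] n \<otimes> (x [^] (n * e) \<otimes> u (Suc e))"
    by (simp only: u_eq[symmetric]) (simp add: m_assoc[symmetric] nat_pow_mult)
  also have "\<dots> = x [^] (c + N) \<otimes> (x [^] n \<otimes> b)" using b by (simp add: m_lcomm)
  finally have "x [^] N \<otimes> r [^] Suc e = x [^] N \<otimes> (x [^] n \<otimes> b)"
    using b by (intro pow_cancel) simp_all
  also have "\<dots> = x [^] (N + n) \<otimes> b" using b by (simp add: m_assoc[symmetric] nat_pow_mult)
  finally show ?thesis using b by (simp add: PIdl_multI)
qed

text \<open>Up to torsion r = x s, so the factor x^m in r^m = x^m s^m cancels against x^((n+1)m).
  The cancellation raises the exponent from \<open>c\<close> to \<open>N + c\<close>.\<close>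

lemma almost_integral_divide:
  assumes r: "r \<in> almost_integral R (x [^] Suc n)" and s: "s \<in> carrier R"
    and eq: "x [^] (L::nat) \<otimes> r = x [^] Suc L \<otimes> s"
  shows "s \<in> almost_integral R (x [^] n)"
proof -
  have rc: "r \<in> carrier R" using r by (simp add: almost_integral_def)
  obtain c :: nat where c: "\<And>m::nat. x [^] c \<otimes> r [^] m \<in> PIdl (x [^] (Suc n * m))"
    using almost_integral_powD[OF x_closed r] by blast
  have "x [^] (N + c) \<otimes> s [^] m \<in> PIdl (x [^] (n * m))" for m :: nat
  proof -
    obtain w where w: "w \<in> carrier R" "x [^] c \<otimes> r [^] m = x [^] (Suc n * m) \<otimes> w"
      using c[of m] PIdl_iff[of "x [^] (Suc n * m)"] by blast
    have "x [^] (Suc L * m) \<otimes> (x [^] c \<otimes> s [^] m) = x [^] c \<otimes> (x [^] (Suc L * m) \<otimes> s [^] m)"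
      using s by (intro m_lcomm) auto
    also have "\<dots> = x [^] c \<otimes> (x [^] Suc L \<otimes> s) [^] m"
      using s by (simp only: nat_pow_distrib nat_pow_pow nat_pow_closed x_closed)
    also have "\<dots> = x [^] c \<otimes> (x [^] L \<otimes> r) [^] m" by (simp only: eq)
    also have "\<dots> = x [^] (L * m) \<otimes> (x [^] c \<otimes> r [^] m)"
      using rc by (simp add: nat_pow_distrib nat_pow_pow m_lcomm)
    also have "\<dots> = x [^] (Suc L * m) \<otimes> (x [^] (n * m) \<otimes> w)"
      unfolding w(2) using w(1) by (simp add: m_assoc[symmetric] nat_pow_mult add_ac)
    finally have "x [^] N \<otimes> (x [^] c \<otimes> s [^] m) = x [^] N \<otimes> (x [^] (n * m) \<otimes> w)"
      using s w(1) by (intro pow_cancel) simp_all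
    hence "x [^] (N + c) \<otimes> s [^] m = x [^] (n * m) \<otimes> (x [^] N \<otimes> w)"
      using s w(1) by (simp add: nat_pow_mult[symmetric] m_assoc m_lcomm)
    thus ?thesis using w(1) by (simp add: PIdl_multI)
  qed
  thus ?thesis by (intro almost_integral_powI s) simp_all
qed

text \<open>Up to torsion, an element at level n + j + 1 is \<open>x\<close> times one at level n +
  j. Each such division contributes a further factor \<open>x\<close> while \<open>L\<close> stays
  fixed.\<close>

lemma almost_integral_pow_linear:
  assumes L: "\<And>r. r \<in> almost_integral R (x [^] n) \<Longrightarrow> x [^] L \<otimes> r \<in> PIdl (x [^] Suc L)"
    and r: "r \<in> almost_integral R (x [^] (n + j))"
  shows "x [^] (L::nat) \<otimes> r \<in> PIdl (x [^] Suc (L + j))"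
  using r
proof (induction j arbitrary: r)
  case 0 thus ?case using L by simp
next
  case (Suc j)
  have rc: "r \<in> carrier R" using Suc.prems by (simp add: almost_integral_def)
  have "r \<in> almost_integral R (x [^] n)"
    using Suc.prems almost_integral_pow_antimono[OF x_closed, of n "n + Suc j"] by auto
  then obtain s where s: "s \<in> carrier R" "x [^] L \<otimes> r = x [^] Suc L \<otimes> s"
    using L PIdl_iff[of "x [^] Suc L"] by blast
  have "s \<in> almost_integral R (x [^] (n + j))"
    using almost_integral_divide[OF _ s] Suc.prems by simp
  then obtain w where w: "w \<in> carrier R" "x [^] L \<otimes> s = x [^] Suc (L + j) \<otimes> w"
    using Suc.IH PIdl_iff[of "x [^] Suc (L + j)"] by blast
  have "x [^] L \<otimes> r = x \<otimes> (x [^] L \<otimes> s)" using s by (simp add: m_ac)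
  also have "\<dots> = x [^] Suc (L + Suc j) \<otimes> w" unfolding w(2) using w(1) by (simp add: m_ac)
  finally show ?case using PIdl_multI[OF _ w(1), of "x [^] Suc (L + Suc j)"] by simp
qed

lemma uniform_multiplier:
  assumes L: "\<And>r. r \<in> almost_integral R (x [^] n) \<Longrightarrow> x [^] L \<otimes> r \<in> PIdl (x [^] Suc L)"
    and y: "y \<in> carrier R" "x \<in> radical R (PIdl y)" and r: "r \<in> almost_integral R y"
  shows "x [^] (N + (L + n)) \<otimes> r \<in> PIdl y"
proof -
  have rc: "r \<in> carrier R" using r by (simp add: almost_integral_def)
  obtain p :: nat where "x [^] p \<in> PIdl y" using y by (auto simp: radical_def)
  then obtain z0 where z0: "z0 \<in> carrier R" "x [^] p = y \<otimes> z0" using y by (auto simp: PIdl_iff)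
  \<comment> \<open>The factor x^n raises the level to n + p, where the hypothesis on
    \<open>L\<close> applies. Since x^L z r is only known to be divisible by x^(L+p+1), another x^n
    is needed before x^(n+p) can be cancelled at the cost of x^N; \<open>p\<close>, and with it the
    dependence on \<open>y\<close>, disappears.\<close>
  define z where "z = x [^] n \<otimes> z0"
  have z: "z \<in> carrier R" "x [^] (n + p) = y \<otimes> z"
    using z0 y by (simp_all add: z_def nat_pow_mult[symmetric] m_lcomm)
  obtain d :: nat where d: "\<And>m::nat. y [^] d \<otimes> r [^] m \<in> PIdl (y [^] m)"
    using r by (auto simp: almost_integral_def)
  have "z \<otimes> r \<in> almost_integral R (x [^] (n + p))"
  proof (rule almost_integral_powI)
    fix m :: nat
    obtain w where w: "w \<in> carrier R" "y [^] d \<otimes> r [^] m = y [^] m \<otimes> w"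
      using d[of m] PIdl_iff[of "y [^] m"] y by blast
    have "x [^] ((n + p) * d) \<otimes> (z \<otimes> r) [^] m = (z [^] d \<otimes> z [^] m) \<otimes> (y [^] d \<otimes> r [^] m)"
      using z y rc by (simp add: nat_pow_pow[symmetric] nat_pow_distrib m_ac)
    also have "\<dots> = (y \<otimes> z) [^] m \<otimes> (z [^] d \<otimes> w)"
      unfolding w(2) using z(1) y w(1) by (simp add: nat_pow_distrib m_ac)
    also have "\<dots> = x [^] ((n + p) * m) \<otimes> (z [^] d \<otimes> w)" by (simp add: nat_pow_pow[symmetric] z(2))
    finally show "x [^] ((n + p) * d) \<otimes> (z \<otimes> r) [^] m \<in> PIdl (x [^] ((n + p) * m))"
      using z(1) w(1) by (simp add: PIdl_multI)
  qed (use z rc in simp_all)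
  hence "x [^] L \<otimes> (z \<otimes> r) \<in> PIdl (x [^] Suc (L + p))"
    using almost_integral_pow_linear[of n L "z \<otimes> r" p] L by blast
  then obtain w where w: "w \<in> carrier R" "x [^] L \<otimes> (z \<otimes> r) = x [^] Suc (L + p) \<otimes> w"
    using PIdl_iff[of "x [^] Suc (L + p)"] by blast
  have "x [^] (n + p) \<otimes> (x [^] (L + n) \<otimes> r) = y \<otimes> (x [^] n \<otimes> (x [^] L \<otimes> (z \<otimes> r)))"
    unfolding z(2) using z(1) y rc by (simp add: nat_pow_mult[symmetric] m_ac)
  also have "\<dots> = x [^] (n + p) \<otimes> (y \<otimes> (x [^] Suc L \<otimes> w))"
    unfolding w(2) using y w(1) by (simp add: nat_pow_mult[symmetric] m_ac)
  finally have "x [^] N \<otimes> (x [^] (L + n) \<otimes> r) = x [^] N \<otimes> (y \<otimes> (x [^] Suc L \<otimes> w))"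
    using y rc w(1) by (intro pow_cancel) simp_all
  hence "x [^] (N + (L + n)) \<otimes> r = y \<otimes> (x [^] N \<otimes> (x [^] Suc L \<otimes> w))"
    using y rc w(1) by (simp add: nat_pow_mult[symmetric] m_assoc m_lcomm[of "x [^] N" y])
  thus ?thesis using y w(1) by (simp add: PIdl_multI)
qed

end

section \<open>Nilpotents in the completion\<close>

context cring
begin

section \<open>Ideals as submodules, and the effect of finite length\<close>

lemma ideal_submodule:
  assumes P: "ideal P R" and D: "ideal D R" "D \<subseteq> P"
  shows "submodule D R (ideal_module R P)"
proof -
  interpret W: module R "ideal_module R P" by (rule ideal_module_module[OF P])
  interpret D: ideal D R by (rule D(1))
  show ?thesis
  proof (rule W.submoduleI)
    show "\<ominus>\<^bsub>ideal_module R P\<^esub> a \<in> D" if a: "a \<in> D" for a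
    proof -
      have aP: "a \<in> carrier (ideal_module R P)" using a D(2) by (auto simp: ideal_module_def)
      have "\<ominus>\<^bsub>ideal_module R P\<^esub> a = \<ominus>\<^bsub>ideal_module R P\<^esub> (\<one> \<odot>\<^bsub>ideal_module R P\<^esub> a)"
        using aP by simp
      also have "\<dots> = (\<ominus> \<one>) \<odot>\<^bsub>ideal_module R P\<^esub> a" using aP by (intro W.smult_l_minus[symmetric]) simp_all
      also have "\<dots> = (\<ominus> \<one>) \<otimes> a" by (simp add: ideal_module_def)
      also have "\<dots> \<in> D" using a by (simp add: D.I_l_closed)
      finally show ?thesis .
    qed
  qed (use D(2) in \<open>auto simp: ideal_module_def D.I_l_closed\<close>)
qed

text \<open>The submodules z^i P descend, and finite length forces z^(L+1) P = z^L P for some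
  \<open>L\<close>; from there on equality repeats.\<close>

lemma finite_length_mult_stable:
  assumes P: "ideal P R" and len: "module_length R (ideal_module R P) < \<infinity>" and z: "z \<in> carrier R"
  shows "\<exists>L::nat. \<forall>p\<in>P. \<forall>i. \<exists>q\<in>P. z [^] L \<otimes> p = z [^] (L + i) \<otimes> q"
proof -
  interpret P: ideal P R by (rule P)
  let ?D = "\<lambda>i::nat. (\<otimes>) (z [^] i) ` P"
  have D: "ideal (?D i) R" "?D i \<subseteq> P" for i
    using z by (auto intro!: ideal_image_mult[OF P] P.I_l_closed)
  have D_Suc: "?D (Suc i) \<subseteq> ?D i" for i
  proof
    fix a assume "a \<in> ?D (Suc i)"
    then obtain p where p: "p \<in> P" "a = z [^] Suc i \<otimes> p" by blast
    hence "a = z [^] i \<otimes> (z \<otimes> p)" using z P.Icarr by (simp add: m_assoc)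
    thus "a \<in> ?D i" using p(1) z P.I_l_closed by blast
  qed
  obtain k where k: "module_length R (ideal_module R P) = enat k" using len by (cases "module_length R (ideal_module R P)") auto
  have "\<exists>L. ?D (Suc L) = ?D L"
  proof (rule ccontr)
    assume *: "\<nexists>L. ?D (Suc L) = ?D L"
    \<comment> \<open>Length is defined by increasing chains, so the indices are reversed; k + 1
      strict steps exceed the length \<open>k\<close>.\<close>
    let ?N = "\<lambda>i. ?D (Suc k - i)"
    have "?N i \<subset> ?N (Suc i)" if "i < Suc k" for i
      using * D_Suc[of "k - i"] that by (auto simp: Suc_diff_le)
    hence "enat (Suc k) \<in> {enat n |n. \<exists>N. (\<forall>i\<le>n. submodule (N i) R (ideal_module R P)) \<and> (\<forall>i<n. N i \<subset> N (Suc i))}"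
      using ideal_submodule[OF P D] by (intro CollectI exI[of _ "Suc k"] conjI exI[of _ ?N]) auto
    hence "enat (Suc k) \<le> module_length R (ideal_module R P)"
      unfolding module_length_def by (rule Sup_upper)
    thus False by (simp add: k)
  qed
  then obtain L where L: "?D (Suc L) = ?D L" by blast
  have "\<exists>q\<in>P. z [^] L \<otimes> p = z [^] (L + i) \<otimes> q" if p: "p \<in> P" for p i
  proof (induction i)
    case 0 show ?case using p by auto
  next
    case (Suc i)
    then obtain q where q: "q \<in> P" "z [^] L \<otimes> p = z [^] (L + i) \<otimes> q" by blast
    have "z [^] L \<otimes> q \<in> ?D (Suc L)" unfolding L using q(1) by blast
    then obtain s where s: "s \<in> P" "z [^] L \<otimes> q = z [^] Suc L \<otimes> s" by blast
    have c: "q \<in> carrier R" "s \<in> carrier R" using q s P.Icarr by blast+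
    have "z [^] (L + i) \<otimes> q = z [^] i \<otimes> (z [^] L \<otimes> q)"
      using z c by (simp add: m_assoc[symmetric] nat_pow_mult add.commute)
    also have "\<dots> = z [^] (L + Suc i) \<otimes> s"
      unfolding s(2) using z c by (simp add: m_assoc[symmetric] nat_pow_mult add.commute del: nat_pow_Suc)
    finally show ?case using q(2) s(1) by auto
  qed
  thus ?thesis by blast
qed

section \<open>Elements of the completion as sequences of cosets\<close>

context
  fixes I assumes I: "ideal I R"
begin

lemma adic_carrier_iff:
  "a \<in> carrier (adic_completion R I) \<longleftrightarrow>
     (\<forall>n. a n \<in> carrier (R Quot ideal_pow R I n)) \<and> (\<forall>n. a (Suc n) \<subseteq> a n)"
  by (simp add: adic_completion_def)

lemma adic_mult_apply:
  "(a \<otimes>\<^bsub>adic_completion R I\<^esub> b) n = a n \<otimes>\<^bsub>R Quot ideal_pow R I n\<^esub> b n"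
  by (simp add: adic_completion_def)

lemma adic_pow_apply:
  "(a [^]\<^bsub>adic_completion R I\<^esub> (m::nat)) n = a n [^]\<^bsub>R Quot ideal_pow R I n\<^esub> m"
proof (induction m)
  case 0 show ?case by (simp add: adic_completion_def nat_pow_def)
next
  case (Suc m)
  have "(a [^]\<^bsub>adic_completion R I\<^esub> Suc m) n
      = (a [^]\<^bsub>adic_completion R I\<^esub> m) n \<otimes>\<^bsub>R Quot ideal_pow R I n\<^esub> a n"
    by (simp add: nat_pow_def adic_mult_apply)
  thus ?case unfolding Suc by (simp add: nat_pow_def)
qed

lemma adic_zero_apply: "\<zero>\<^bsub>adic_completion R I\<^esub> n = ideal_pow R I n"
  by (simp add: adic_completion_def FactRing_def)

lemma coset_pow:
  assumes "t \<in> carrier R"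
  shows "(ideal_pow R I n +> t) [^]\<^bsub>R Quot ideal_pow R I n\<^esub> (m::nat) = ideal_pow R I n +> t [^] m"
  using ring_hom_cring.hom_pow[OF ideal.rcos_ring_hom_cring[OF ideal_pow_ideal[OF I] cring_axioms] assms]
  by simp

lemma coset_mult:
  assumes "s \<in> carrier R" "t \<in> carrier R"
  shows "(ideal_pow R I n +> s) \<otimes>\<^bsub>R Quot ideal_pow R I n\<^esub> (ideal_pow R I n +> t) = ideal_pow R I n +> (s \<otimes> t)"
  using ideal.rcoset_mult_add[OF ideal_pow_ideal[OF I] assms] by (simp add: FactRing_def)

lemma coset_eq_ideal_iff:
  assumes "t \<in> carrier R"
  shows "ideal_pow R I n +> t = ideal_pow R I n \<longleftrightarrow> t \<in> ideal_pow R I n"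
proof -
  interpret In: ideal "ideal_pow R I n" R by (rule ideal_pow_ideal[OF I])
  show ?thesis using In.a_rcos_const In.rcos_const_imp_mem[OF assms] by auto
qed

lemma coset_seq_in_adic_completion:
  assumes t: "\<And>n. t n \<in> carrier R" "\<And>n. t (Suc n) \<ominus> t n \<in> ideal_pow R I n"
  shows "(\<lambda>n. ideal_pow R I n +> t n) \<in> carrier (adic_completion R I)"
proof -
  have "ideal_pow R I n +> t n \<in> carrier (R Quot ideal_pow R I n)" for n
    using a_rcosetsI[OF ideal_carrier[OF ideal_pow_ideal[OF I]] t(1)] by (simp add: FactRing_def)
  moreover have "ideal_pow R I (Suc n) +> t (Suc n) \<subseteq> ideal_pow R I n +> t n" for n
  proof
    interpret In: ideal "ideal_pow R I n" R by (rule ideal_pow_ideal[OF I])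
    fix a assume "a \<in> ideal_pow R I (Suc n) +> t (Suc n)"
    then obtain h where h: "h \<in> ideal_pow R I (Suc n)" "a = h \<oplus> t (Suc n)"
      by (auto simp: a_r_coset_def r_coset_def)
    have hI: "h \<in> ideal_pow R I n" using h(1) ideal_pow_Suc[OF I] by blast
    have "a = (h \<oplus> (t (Suc n) \<ominus> t n)) \<oplus> t n"
      using h(2) t(1) In.Icarr[OF hI] by (simp add: a_minus_def a_assoc l_neg)
    moreover have "h \<oplus> (t (Suc n) \<ominus> t n) \<in> ideal_pow R I n" using hI t(2) by (rule In.a_closed)
    ultimately show "a \<in> ideal_pow R I n +> t n" by (auto simp: a_r_coset_def r_coset_def)
  qed
  ultimately show ?thesis unfolding adic_carrier_iff by blast
qed

text \<open>A Cauchy sequence \<open>t\<close> with \<open>t n ^ E \<in> I^n\<close> is a nilpotent element of the completion.\<close>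

lemma nilpotent_sequences_annihilated:
  assumes x: "x \<in> I"
    and len: "module_length (adic_completion R I)
      (ideal_module (adic_completion R I) (nilradical (adic_completion R I))) < \<infinity>"
  shows "\<exists>L::nat. \<forall>t (E::nat). (\<forall>n. t n \<in> carrier R) \<longrightarrow> (\<forall>n. t (Suc n) \<ominus> t n \<in> ideal_pow R I n) \<longrightarrow>
    (\<forall>n. t n [^] E \<in> ideal_pow R I n) \<longrightarrow> (\<forall>n. x [^] L \<otimes> t n \<in> ideal_pow R I n)"
proof -
  let ?A = "adic_completion R I" and ?Q = "\<lambda>n. ideal_pow R I n"
  interpret A: cring ?A by (rule adic_completion_cring[OF I])
  have xc: "x \<in> carrier R" using x ideal.Icarr[OF I] by blast
  define X where "X = (\<lambda>n. ?Q n +> x)"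
  have X: "X \<in> carrier ?A"
  proof -
    have "x \<ominus> x \<in> ?Q n" for n
      using xc additive_subgroup.zero_closed[OF ideal.axioms(1)[OF ideal_pow_ideal[OF I]]]
      by (simp add: a_minus_def r_neg)
    thus ?thesis unfolding X_def using xc by (intro coset_seq_in_adic_completion)
  qed
  have "ideal (nilradical ?A) ?A"
    unfolding nilradical_def by (rule A.radical_ideal[OF A.zeroideal])
  then obtain L :: nat where L: "\<And>p i. p \<in> nilradical ?A \<Longrightarrow>
      \<exists>q\<in>nilradical ?A. X [^]\<^bsub>?A\<^esub> L \<otimes>\<^bsub>?A\<^esub> p = X [^]\<^bsub>?A\<^esub> (L + i) \<otimes>\<^bsub>?A\<^esub> q"
    using A.finite_length_mult_stable[OF _ len X] by blast
  have "x [^] L \<otimes> t n \<in> ?Q n"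
    if t: "\<And>n. t n \<in> carrier R" "\<And>n. t (Suc n) \<ominus> t n \<in> ?Q n" "\<And>n. t n [^] E \<in> ?Q n"
    for t and E n :: nat
  proof -
    interpret In: ideal "?Q n" R by (rule ideal_pow_ideal[OF I])
    define T where "T = (\<lambda>n. ?Q n +> t n)"
    have T: "T \<in> carrier ?A" unfolding T_def by (rule coset_seq_in_adic_completion[OF t(1,2)])
    have "T [^]\<^bsub>?A\<^esub> E = \<zero>\<^bsub>?A\<^esub>"
    proof
      fix n
      have "(T [^]\<^bsub>?A\<^esub> E) n = ?Q n +> t n [^] E"
        unfolding adic_pow_apply by (simp only: T_def coset_pow[OF t(1)])
      thus "(T [^]\<^bsub>?A\<^esub> E) n = \<zero>\<^bsub>?A\<^esub> n"
        unfolding adic_zero_apply using coset_eq_ideal_iff[of "t n [^] E"] t by simp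
    qed
    hence "T \<in> nilradical ?A" using T by (auto simp: nilradical_def radical_def)
    \<comment> \<open>The exponent is adapted to the component: modulo I^n the right side x^(L+n) s
      vanishes, because \<open>x\<close> lies in \<open>I\<close>.\<close>
    then obtain q where q: "q \<in> nilradical ?A" "X [^]\<^bsub>?A\<^esub> L \<otimes>\<^bsub>?A\<^esub> T = X [^]\<^bsub>?A\<^esub> (L + n) \<otimes>\<^bsub>?A\<^esub> q"
      using L by blast
    have "q n \<in> carrier (R Quot ?Q n)" using q(1) by (auto simp: nilradical_def radical_def adic_carrier_iff)
    then obtain s where s: "s \<in> carrier R" "q n = ?Q n +> s" by (auto simp: FactRing_def A_RCOSETS_def')
    have "(X [^]\<^bsub>?A\<^esub> L \<otimes>\<^bsub>?A\<^esub> T) n = ?Q n +> (x [^] L \<otimes> t n)"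
      unfolding adic_mult_apply adic_pow_apply X_def T_def by (simp only: coset_pow[OF xc] coset_mult t(1) nat_pow_closed xc)
    moreover have "(X [^]\<^bsub>?A\<^esub> (L + n) \<otimes>\<^bsub>?A\<^esub> q) n = ?Q n +> (x [^] (L + n) \<otimes> s)"
      unfolding adic_mult_apply adic_pow_apply X_def s(2) by (simp only: coset_pow[OF xc] coset_mult s(1) nat_pow_closed xc)
    moreover have "x [^] (L + n) \<otimes> s \<in> ?Q n"
    proof -
      have "x [^] (L + n) \<otimes> s = (x [^] L \<otimes> s) \<otimes> x [^] n"
        using xc s(1) by (simp add: nat_pow_mult[symmetric] m_ac)
      thus ?thesis using pow_in_ideal_pow[OF I x] xc s(1) by (simp add: In.I_l_closed)
    qed
    ultimately have "?Q n +> (x [^] L \<otimes> t n) = ?Q n"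
      using q(2) coset_eq_ideal_iff[of "x [^] (L + n) \<otimes> s" n] xc s(1) by simp
    thus ?thesis using coset_eq_ideal_iff[of "x [^] L \<otimes> t n" n] xc t(1) by simp
  qed
  thus ?thesis by blast
qed

end

end

section \<open>Bounding Goto numbers\<close>

context cring
begin

lemma ideal_pow_antimono:
  assumes "ideal I R" "i \<le> j"
  shows "ideal_pow R I j \<subseteq> ideal_pow R I i"
  using lift_Suc_antimono_le[of "ideal_pow R I", OF ideal_pow_Suc[OF assms(1)] assms(2)] .

lemma ideal_subset_integral_closure:
  assumes I: "ideal I R"
  shows "I \<subseteq> ideal_integral_closure R I"
proof
  fix r assume r: "r \<in> I"
  interpret I: ideal I R by (rule I)
  have rc: "r \<in> carrier R" using r by (rule I.Icarr)
  have "\<ominus> r \<in> ideal_pow R I 1" using pow_in_ideal_pow[OF I I.a_inv_closed[OF r], of 1] rc by simp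
  moreover have "r [^] (1::nat) \<oplus> (\<Oplus>i\<in>{1..1}. \<ominus> r \<otimes> r [^] (1 - i :: nat)) = \<zero>"
    using rc finsum_insert[of "{}" "1::nat" "\<lambda>i. \<ominus> r \<otimes> r [^] (1 - i)"] by (simp add: r_neg)
  ultimately show "r \<in> ideal_integral_closure R I"
    unfolding ideal_integral_closure_def using rc
    by (intro CollectI conjI exI[of _ "1::nat"] exI[of _ "\<lambda>_. \<ominus> r"]) auto
qed

end

section \<open>Existence of a multiplier for the powers of one parameter\<close>

context bounded_parameter
begin

text \<open>Chevalley's argument: an element of the stable value of \<open>almost_integral (x^n) + xR\<close> lifts to a
  Cauchy sequence whose product with \<open>x\<close> is nilpotent in the completion.\<close>

lemma almost_integral_multiplier_exists:
  assumes len: "module_length (adic_completion R M)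
      (ideal_module (adic_completion R M) (nilradical (adic_completion R M))) < \<infinity>"
  shows "\<exists>L n::nat. \<forall>r\<in>almost_integral R (x [^] n). x [^] L \<otimes> r \<in> PIdl (x [^] Suc L)"
proof -
  obtain L :: nat where L: "\<And>t (E::nat) n. (\<And>n. t n \<in> carrier R) \<Longrightarrow>
      (\<And>n. t (Suc n) \<ominus> t n \<in> ideal_pow R M n) \<Longrightarrow> (\<And>n. t n [^] E \<in> ideal_pow R M n) \<Longrightarrow>
      x [^] L \<otimes> t n \<in> ideal_pow R M n"
    using nilpotent_sequences_annihilated[OF ideal_M x_in_M len] by blast
  let ?P = "\<lambda>j::nat. PIdl (x [^] j)"
  let ?J = "\<lambda>n::nat. almost_integral R (x [^] n)"
  have P: "ideal (?P j) R" for j by (intro cgenideal_ideal) simp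
  have J: "ideal (?J n) R" for n by (intro ideal_almost_integral) simp
  have P_pow: "?P j \<subseteq> ideal_pow R M n" if "n \<le> j" for n j
  proof -
    have "?P n \<subseteq> ideal_pow R M n"
      by (intro cgenideal_minimal ideal_pow_ideal ideal_M pow_in_ideal_pow x_in_M)
    thus ?thesis using PIdl_pow_mono[OF x_closed that] by blast
  qed
  define D where "D = (\<lambda>j n. ?J n <+>\<^bsub>R\<^esub> ?P j)"
  have D: "ideal (D j n) R" for j n unfolding D_def by (rule add_ideals[OF J P])
  have JD: "?J n \<subseteq> D j n" for j n unfolding D_def by (rule subset_add_ideals1[OF J P])
  have D_mono: "D j k \<subseteq> D j n" if "n \<le> k" for j n k
    unfolding D_def using almost_integral_pow_antimono[OF x_closed that] by (intro add_ideals_mono) auto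
  have "\<exists>n. \<forall>k\<ge>n. D j k = D j n" for j
  proof -
    obtain l where l: "\<And>h. ideal_chain R h (?P j) (carrier R) \<Longrightarrow> h \<le> l"
      using finite_colength[OF P M_subset_radical_PIdl_pow] by blast
    show ?thesis
    proof (rule descending_ideals_stable[OF l])
      show "?P j \<subseteq> D j n" for n unfolding D_def by (rule subset_add_ideals2[OF J P])
      show "D j n \<subseteq> carrier R" for n by (rule ideal_carrier[OF D])
      show "D j (Suc n) \<subseteq> D j n" for n by (rule D_mono) simp
    qed (auto intro: D P oneideal)
  qed
  \<comment> \<open>R/x^j R has finite length, so for each \<open>j\<close> the descending ideals
    \<open>D j n\<close> are constant from some index \<open>s j\<close> on.\<close>
  then obtain s where s: "\<And>j k. s j \<le> k \<Longrightarrow> D j k = D j (s j)" by metis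
  define K where "K = (\<lambda>j. D j (s j))"
  have K_eq: "K j = D j k" if "s j \<le> k" for j k unfolding K_def using s[OF that] by simp
  have K_sub: "K j \<subseteq> D j n" for j n
    using K_eq[of j "max n (s j)"] D_mono[of n "max n (s j)" j] by simp
  have K_carrier: "K j \<subseteq> carrier R" for j unfolding K_def by (rule ideal_carrier[OF D])
  \<comment> \<open>At a level beyond both stable indices, r = a + b with \<open>a\<close> almost
    integral. Then \<open>a\<close> already lies in the next stable ideal and differs from
    \<open>r\<close> by an element of x^j R.\<close>
  have lift: "\<exists>r'\<in>K (Suc j). r' \<ominus> r \<in> ?P j" if r: "r \<in> K j" for r j
  proof -
    interpret P: ideal "?P j" R by (rule P)
    let ?k = "max (s j) (s (Suc j))"
    have "r \<in> D j ?k" using r K_eq[of j ?k] by simp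
    then obtain a b where ab: "a \<in> ?J ?k" "b \<in> ?P j" "r = a \<oplus> b"
      unfolding D_def mem_add_ideals_iff by blast
    have c: "a \<in> carrier R" "b \<in> carrier R" using ab ideal.Icarr[OF J] P.Icarr by blast+
    have "a \<in> K (Suc j)" using ab(1) JD K_eq[of "Suc j" ?k] by auto
    moreover have "a \<ominus> r = \<ominus> b" using c by (simp add: ab(3) a_minus_def minus_add a_assoc[symmetric] r_neg)
    ultimately show ?thesis using P.a_inv_closed[OF ab(2)] by metis
  qed
  have "x [^] Suc L \<otimes> r \<in> ?P (Suc (Suc L))" if r: "r \<in> K 1" for r
  proof -
    \<comment> \<open>The index is shifted by one, so the whole sequence stays congruent to
      \<open>r\<close> modulo \<open>x\<close>.\<close>
    have "\<exists>f. \<forall>n. (f n \<in> K (Suc n) \<and> (n = 0 \<longrightarrow> f n = r)) \<and> f (Suc n) \<ominus> f n \<in> ?P (Suc n)"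
    proof (rule dependent_nat_choice)
      show "\<exists>y. y \<in> K (Suc 0) \<and> (0 = (0::nat) \<longrightarrow> y = r)" using r by auto
      show "\<exists>z. (z \<in> K (Suc (Suc n)) \<and> (Suc n = 0 \<longrightarrow> z = r)) \<and> z \<ominus> y \<in> ?P (Suc n)"
        if "y \<in> K (Suc n) \<and> (n = 0 \<longrightarrow> y = r)" for y n
        using lift[of y "Suc n"] that by auto
    qed
    then obtain f where f: "\<And>n. f n \<in> K (Suc n)" "f 0 = r" "\<And>n. f (Suc n) \<ominus> f n \<in> ?P (Suc n)"
      by blast
    have fc [simp]: "f n \<in> carrier R" for n using f(1) K_carrier by blast
    define t where "t = (\<lambda>n. x \<otimes> f n)"
    have tc: "t n \<in> carrier R" for n by (simp add: t_def)
    have t_diff: "t (Suc n) \<ominus> t n \<in> ideal_pow R M n" for n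
    proof -
      have "t (Suc n) \<ominus> t n = x \<otimes> (f (Suc n) \<ominus> f n)"
        by (simp add: t_def a_minus_def r_distr r_minus)
      also have "\<dots> \<in> ?P (Suc n)" using f(3) by (intro ideal.I_l_closed[OF P]) simp_all
      finally show ?thesis using P_pow[of n "Suc n"] by auto
    qed
    \<comment> \<open>In f n = a + b the degree bound handles a^(e+1) and all other terms contain
      \<open>b\<close>, but only after multiplication by x^N. Passing from \<open>f\<close> to t = x
      f supplies that factor within the exponent e + 1 + N, which does not depend on
      \<open>n\<close>.\<close>
    have t_pow: "t n [^] (Suc e + N) \<in> ideal_pow R M n" for n
    proof -
      interpret P: ideal "?P (Suc n)" R by (rule P)
      have "f n \<in> D (Suc n) (Suc n)" using f(1) K_sub by blast
      then obtain a b where ab: "a \<in> ?J (Suc n)" "b \<in> ?P (Suc n)" "f n = a \<oplus> b"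
        unfolding D_def mem_add_ideals_iff by blast
      have c: "a \<in> carrier R" "b \<in> carrier R" using ab ideal.Icarr[OF J] P.Icarr by blast+
      have "x [^] N \<otimes> (a \<oplus> b) [^] Suc e \<in> ?P (Suc n)"
      proof (rule mem_add_pow_closed[OF P c])
        fix i j assume ij: "i + j = Suc e"
        show "x [^] N \<otimes> a [^] i \<otimes> b [^] j \<in> ?P (Suc n)"
        proof (cases j)
          case 0
          hence "x [^] N \<otimes> a [^] i \<otimes> b [^] j = x [^] N \<otimes> a [^] Suc e" using ij c by simp
          thus ?thesis using almost_integral_degree_bound[OF ab(1)]
              PIdl_pow_mono[OF x_closed, of "Suc n" "N + Suc n"] by auto
        next
          case (Suc k)
          hence "x [^] N \<otimes> a [^] i \<otimes> b [^] j = (x [^] N \<otimes> a [^] i \<otimes> b [^] k) \<otimes> b"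
            using c by (simp add: m_assoc)
          moreover have "(x [^] N \<otimes> a [^] i \<otimes> b [^] k) \<otimes> b \<in> ?P (Suc n)"
            using ab(2) c by (intro P.I_l_closed) simp_all
          ultimately show ?thesis by (simp only:)
        qed
      qed simp
      hence "(x [^] Suc e \<otimes> f n [^] N) \<otimes> (x [^] N \<otimes> f n [^] Suc e) \<in> ?P (Suc n)"
        unfolding ab(3)[symmetric] by (rule P.I_l_closed) simp
      moreover have "t n [^] (Suc e + N) = (x [^] Suc e \<otimes> f n [^] N) \<otimes> (x [^] N \<otimes> f n [^] Suc e)"
      proof -
        have "t n [^] (Suc e + N) = x [^] (Suc e + N) \<otimes> f n [^] (N + Suc e)"
          by (simp only: t_def nat_pow_distrib x_closed fc add.commute[of N])
        thus ?thesis by (simp add: nat_pow_mult[symmetric] m_ac)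
      qed
      ultimately show ?thesis using P_pow[of n "Suc n"] by auto
    qed
    \<comment> \<open>At this \<open>k\<close>, membership in M^k implies divisibility by x^(L+2),
      so a single term of the sequence suffices.\<close>
    obtain k where k: "ideal_pow R M k \<subseteq> ?P (Suc (Suc L))"
      using ideal_pow_M_subset[OF P M_subset_radical_PIdl_pow] by blast
    have "x [^] L \<otimes> t k \<in> ideal_pow R M k" by (rule L[OF tc t_diff t_pow])
    hence 1: "x [^] Suc L \<otimes> f k \<in> ?P (Suc (Suc L))" using k by (auto simp: t_def m_assoc)
    have "f n \<ominus> f 0 \<in> ?P 1" for n
    proof (induction n)
      case 0
      show ?case using additive_subgroup.zero_closed[OF ideal.axioms(1)[OF P[of 1]]]
        by (simp add: a_minus_def r_neg)
    next
      case (Suc n)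
      have "f (Suc n) \<ominus> f n \<in> ?P 1" using f(3) PIdl_pow_mono[OF x_closed, of 1 "Suc n"] by auto
      hence "(f (Suc n) \<ominus> f n) \<oplus> (f n \<ominus> f 0) \<in> ?P 1"
        using Suc by (intro additive_subgroup.a_closed[OF ideal.axioms(1)[OF P]])
      moreover have "(f (Suc n) \<ominus> f n) \<oplus> (f n \<ominus> f 0) = f (Suc n) \<ominus> f 0"
        by (simp add: a_minus_def a_assoc r_neg1)
      ultimately show ?case by simp
    qed
    then obtain w where w: "w \<in> carrier R" "f k \<ominus> f 0 = x \<otimes> w" using PIdl_iff[of x] by auto
    \<comment> \<open>Replacing \<open>f k\<close> by \<open>r\<close> changes x^(L+1) f k only by a
      multiple of x^(L+2).\<close>
    have 2: "x [^] Suc L \<otimes> (f k \<ominus> r) \<in> ?P (Suc (Suc L))"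
    proof -
      have "x [^] Suc L \<otimes> (x \<otimes> w) = x [^] Suc (Suc L) \<otimes> w" using w(1) by (simp add: m_assoc)
      thus ?thesis using w(1) PIdl_multI[of "x [^] Suc (Suc L)" w] unfolding f(2)[symmetric] w(2) by simp
    qed
    have rc: "r \<in> carrier R" using fc[of 0] f(2) by simp
    have "x [^] Suc L \<otimes> r = x [^] Suc L \<otimes> f k \<ominus> x [^] Suc L \<otimes> (f k \<ominus> r)"
      using rc by (simp add: a_minus_def r_distr r_minus minus_add a_assoc[symmetric] r_neg)
    also have "\<dots> \<in> ?P (Suc (Suc L))"
    proof -
      interpret P: ideal "?P (Suc (Suc L))" R by (rule P)
      show ?thesis unfolding a_minus_def[of R "x [^] Suc L \<otimes> f k"] by (intro P.a_closed P.a_inv_closed 1 2)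
    qed
    finally show ?thesis .
  qed
  moreover have "?J (s 1) \<subseteq> K 1" unfolding K_def by (rule JD)
  ultimately show ?thesis by blast
qed

end

section \<open>Dimension one: parameters and Goto numbers\<close>

context noetherian_local_ring
begin

lemma bounded_parameter_exists:
  assumes "x \<in> M" "M \<subseteq> radical R (PIdl x)"
  shows "\<exists>N e. bounded_parameter R M x N e"
proof -
  have x: "x \<in> carrier R" using assms(1) Icarr by blast
  obtain N :: nat where "\<forall>j::nat. \<forall>t\<in>carrier R. x [^] j \<otimes> t = \<zero> \<longrightarrow> x [^] N \<otimes> t = \<zero>"
    using pow_torsion_bound[OF x] by blast
  moreover obtain e where "\<forall>h. ideal_chain R h (PIdl x) (carrier R) \<longrightarrow> h \<le> e"
    using finite_colength[OF cgenideal_ideal[OF x] assms(2)] by blast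
  ultimately have "bounded_parameter R M x N e"
    using assms noetherian_local_ring_axioms
    by (auto intro!: bounded_parameter.intro bounded_parameter_axioms.intro)
  thus ?thesis by blast
qed

text \<open>Every prime contains the nilpotents, so a nil \<open>M\<close> would be the only prime
  and the dimension would be 0.\<close>

lemma M_not_nil:
  assumes "krull_dim R = 1"
  shows "\<not> M \<subseteq> radical R {\<zero>}"
proof
  assume nil: "M \<subseteq> radical R {\<zero>}"
  have prime: "P = M" if P: "primeideal P R" for P
  proof -
    interpret P: primeideal P R by (rule P)
    have pow: "m \<in> P" if "m \<in> carrier R" "m [^] (k::nat) \<in> P" for m k
      using that
    proof (induction k)
      case 0 thus ?case using P.one_imp_carrier P.I_notcarr by simp
    next
      case (Suc k) thus ?case using P.I_prime[of "m [^] k" m] by auto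
    qed
    have "M \<subseteq> P"
    proof
      fix m assume "m \<in> M"
      then obtain k :: nat where "m \<in> carrier R" "m [^] k = \<zero>" using nil by (auto simp: radical_def)
      thus "m \<in> P" using pow[of m k] P.zero_closed by simp
    qed
    thus ?thesis using I_maximal[OF P.is_ideal] ideal_carrier[OF P.is_ideal] P.I_notcarr by blast
  qed
  have "n = 0" if "\<forall>i\<le>n. primeideal (P i) R" "\<forall>i<n. P i \<subset> P (Suc i)" for n :: nat and P
  proof (rule ccontr)
    assume "n \<noteq> 0"
    hence "P 0 \<subset> P (Suc 0)" "P 0 = M" "P (Suc 0) = M" using that prime by auto
    thus False by blast
  qed
  hence "krull_dim R \<le> 0"
    unfolding krull_dim_def by (intro Sup_least) (auto simp: zero_enat_def)
  thus False using assms by simp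
qed

text \<open>If 1 belonged to it, then y^c = y^(c+1) s, and since 1 - ys is a unit, y^c = 0, which
  makes \<open>M\<close> nil. Properness is what provides the socle element in the bound on Goto
  numbers.\<close>

lemma almost_integral_proper:
  assumes dim: "krull_dim R = 1" and y: "y \<in> M" "M \<subseteq> radical R (PIdl y)"
  shows "almost_integral R y \<noteq> carrier R"
proof
  assume *: "almost_integral R y = carrier R"
  have yc: "y \<in> carrier R" using y(1) Icarr by blast
  have "\<one> \<in> almost_integral R y" unfolding * by simp
  then obtain c :: nat where c: "\<forall>m::nat. y [^] c \<otimes> \<one> [^] m \<in> PIdl (y [^] m)"
    by (auto simp: almost_integral_def)
  have "y [^] c \<in> PIdl (y [^] Suc c)" using spec[OF c, of "Suc c"] yc by simp
  then obtain s where s: "s \<in> carrier R" "y [^] c = y [^] Suc c \<otimes> s"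
    using PIdl_iff[of "y [^] Suc c"] yc by blast
  have "\<one> \<ominus> y \<otimes> s \<notin> M"
  proof
    assume "\<one> \<ominus> y \<otimes> s \<in> M"
    hence "(\<one> \<ominus> y \<otimes> s) \<oplus> y \<otimes> s \<in> M" using y(1) s(1) by (simp add: a_closed I_r_closed)
    moreover have "(\<one> \<ominus> y \<otimes> s) \<oplus> y \<otimes> s = \<one>" using yc s(1) by (simp add: a_minus_def a_assoc l_neg)
    ultimately show False using one_imp_carrier I_notcarr by simp
  qed
  then obtain v where v: "v \<in> carrier R" "(\<one> \<ominus> y \<otimes> s) \<otimes> v = \<one>"
    using unit_if_notin_M[of "\<one> \<ominus> y \<otimes> s"] yc s(1) by auto
  have "y [^] c \<otimes> (\<one> \<ominus> y \<otimes> s) = y [^] c \<ominus> y [^] Suc c \<otimes> s"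
    using yc s(1) by (simp add: a_minus_def r_distr r_minus m_assoc)
  also have "\<dots> = \<zero>" unfolding s(2)[symmetric] using yc by (simp add: a_minus_def r_neg)
  finally have "y [^] c \<otimes> ((\<one> \<ominus> y \<otimes> s) \<otimes> v) = \<zero>"
    using yc s(1) v(1) by (simp add: m_assoc[symmetric])
  hence y0: "y [^] c = \<zero>" using v yc by simp
  have "M \<subseteq> radical R {\<zero>}"
  proof
    fix m assume m: "m \<in> M"
    hence mc: "m \<in> carrier R" using Icarr by blast
    obtain k :: nat where "m [^] k \<in> PIdl y" using m y(2) by (auto simp: radical_def)
    then obtain w where w: "w \<in> carrier R" "m [^] k = y \<otimes> w" using yc by (auto simp: PIdl_iff)
    have "m [^] (k * c) = (y \<otimes> w) [^] c" using mc by (simp add: nat_pow_pow[symmetric] w(2))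
    also have "\<dots> = \<zero>" using yc w(1) y0 by (simp add: nat_pow_distrib)
    finally show "m \<in> radical R {\<zero>}" using mc by (auto simp: radical_def)
  qed
  thus False using M_not_nil[OF dim] by simp
qed

lemma parameter_ideal_PIdl:
  assumes "krull_dim R = 1" "parameter_ideal R M Q"
  shows "\<exists>y\<in>M. Q = PIdl y \<and> radical R (PIdl y) = M"
proof -
  obtain xs where xs: "set xs \<subseteq> carrier R" "enat (length xs) = 1" "Q = Idl (set xs)" "radical R Q = M"
    using assms by (auto simp: parameter_ideal_def)
  then obtain y where y: "xs = [y]" by (auto simp: one_enat_def length_Suc_conv)
  hence yc: "y \<in> carrier R" and Q: "Q = PIdl y"
    using xs by (auto simp: cgenideal_eq_genideal)
  have "y [^] (1::nat) \<in> PIdl y" using cgenideal_self[OF yc] yc by simp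
  hence "y \<in> radical R (PIdl y)" unfolding radical_def using yc by blast
  thus ?thesis using xs(4) Q by blast
qed

text \<open>A socle element \<open>a\<close> of \<open>R\<close> modulo \<open>almost_integral R y\<close> lies in \<open>Q : M^(k+1)\<close> but not in the
  integral closure of \<open>Q = yR\<close>.\<close>

lemma goto_number_bound:
  assumes dim: "krull_dim R = 1" and y: "y \<in> M" "radical R (PIdl y) = M"
    and k: "\<And>i r. i \<in> ideal_pow R M k \<Longrightarrow> r \<in> almost_integral R y \<Longrightarrow> i \<otimes> r \<in> PIdl y"
  shows "goto_number R M (PIdl y) \<le> k"
proof -
  have yc: "y \<in> carrier R" using y(1) Icarr by blast
  note P = cgenideal_ideal[OF yc] and A = ideal_almost_integral[OF yc]
  have "y [^] (0::nat) \<otimes> y [^] m \<in> PIdl (y [^] m)" for m :: nat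
    using yc cgenideal_self[of "y [^] m"] by simp
  hence "y \<in> almost_integral R y" using yc unfolding almost_integral_def by blast
  hence "PIdl y \<subseteq> almost_integral R y" by (rule cgenideal_minimal[OF A])
  hence "M \<subseteq> radical R (almost_integral R y)" using radical_mono y(2) by metis
  then obtain a where a: "a \<in> carrier R" "a \<notin> almost_integral R y"
      "\<And>m. m \<in> M \<Longrightarrow> a \<otimes> m \<in> almost_integral R y"
    using socle_element_exists[OF A almost_integral_proper[OF dim y(1)]] y(2) by auto
  have mem: "a \<otimes> b \<in> PIdl y" if "b \<in> ideal_pow R M (Suc k)" for b
  proof -
    have "b \<in> ideal_prod R (ideal_pow R M k) M" using that by (simp only: ideal_pow_Suc_eq)
    thus ?thesis
    proof induction
      case (prod i j)
      have "i \<in> carrier R" "j \<in> carrier R"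
        using prod ideal.Icarr[OF ideal_pow_ideal[OF ideal_M]] Icarr by blast+
      hence "a \<otimes> (i \<otimes> j) = i \<otimes> (a \<otimes> j)" using a(1) by (simp add: m_lcomm)
      thus ?case using k[OF prod(1) a(3)[OF prod(2)]] by simp
    next
      case (sum b c)
      have "b \<in> carrier R" "c \<in> carrier R"
        using sum.hyps ideal_prod_in_carrier[OF ideal_pow_ideal[OF ideal_M] ideal_M] by blast+
      thus ?case using sum.IH a(1) additive_subgroup.a_closed[OF ideal.axioms(1)[OF P]]
        by (simp add: r_distr)
    qed
  qed
  let ?G = "\<lambda>g. ideal_colon R (PIdl y) (ideal_pow R M g) \<subseteq> ideal_integral_closure R (PIdl y)"
  have bound: "g \<le> k" if g: "?G g" for g
  proof (rule ccontr)
    assume "\<not> g \<le> k"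
    hence "ideal_pow R M g \<subseteq> ideal_pow R M (Suc k)" by (intro ideal_pow_antimono ideal_M) simp
    hence "a \<in> ideal_colon R (PIdl y) (ideal_pow R M g)"
      unfolding ideal_colon_def using mem a(1) by blast
    hence "a \<in> ideal_integral_closure R (PIdl y)" using g by blast
    thus False using integral_closure_PIdl_subset[OF yc] a(2) by blast
  qed
  have "ideal_colon R (PIdl y) (ideal_pow R M 0) \<subseteq> PIdl y"
  proof
    fix r assume "r \<in> ideal_colon R (PIdl y) (ideal_pow R M 0)"
    hence r: "r \<in> carrier R" "\<forall>b\<in>carrier R. r \<otimes> b \<in> PIdl y"
      unfolding ideal_colon_def ideal_pow_0 by blast+
    thus "r \<in> PIdl y" using bspec[OF r(2) one_closed] by simp
  qed
  \<comment> \<open>\<open>GREATEST\<close> is meaningful only for a bounded predicate with a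
    witness; g = 0 is one, since M^0 = R makes the colon ideal equal to yR.\<close>
  hence "?G 0" using ideal_subset_integral_closure[OF P] by blast
  hence "?G (goto_number R M (PIdl y))"
    unfolding goto_number_def using GreatestI_nat[of ?G 0 k] bound by blast
  thus ?thesis by (rule bound)
qed

end

theorem corollary3p6:
  fixes R :: "('a, 'b) ring_scheme" and M :: "'a set"
  assumes "noetherian_local_ring R M"
    and "krull_dim R = 1"
    and "module_length (adic_completion R M)
           (ideal_module (adic_completion R M) (nilradical (adic_completion R M))) < \<infinity>"
  shows "finite (goto_numbers R M)"
proof (cases "\<exists>Q. parameter_ideal R M Q")
  case False
  hence "goto_numbers R M = {}" by (auto simp: goto_numbers_def)
  thus ?thesis by simp
next
  case True
  interpret noetherian_local_ring R M by (rule assms(1))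
  \<comment> \<open>\<open>x\<close> generates one given parameter ideal, with which all others are
    compared; if there is none, the set is empty, so no parameter has to be constructed.\<close>
  obtain x where x: "x \<in> M" "radical R (PIdl\<^bsub>R\<^esub> x) = M"
    using True parameter_ideal_PIdl[OF assms(2)] by blast
  then obtain N e where "bounded_parameter R M x N e"
    using bounded_parameter_exists[OF x(1)] by blast
  then interpret bounded_parameter R M x N e .
  obtain L n :: nat where L: "\<And>r. r \<in> almost_integral R (x [^]\<^bsub>R\<^esub> n) \<Longrightarrow>
      x [^]\<^bsub>R\<^esub> L \<otimes>\<^bsub>R\<^esub> r \<in> PIdl\<^bsub>R\<^esub> (x [^]\<^bsub>R\<^esub> Suc L)"
    using almost_integral_multiplier_exists[OF assms(3)] by blast
  define K where "K = N + (L + n)"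
  \<comment> \<open>x^K multiplies the almost integral elements of every parameter into its ideal.
    As M^k lies in x^K R, this \<open>k\<close> bounds all Goto numbers at once.\<close>
  obtain k where k: "ideal_pow R M k \<subseteq> PIdl\<^bsub>R\<^esub> (x [^]\<^bsub>R\<^esub> K)"
    using ideal_pow_M_subset[OF cgenideal_ideal M_subset_radical_PIdl_pow] by blast
  have "goto_number R M Q \<le> k" if Q: "parameter_ideal R M Q" for Q
  proof -
    obtain y where y: "y \<in> M" "Q = PIdl\<^bsub>R\<^esub> y" "radical R (PIdl\<^bsub>R\<^esub> y) = M"
      using parameter_ideal_PIdl[OF assms(2) Q] by blast
    have yc: "y \<in> carrier R" using y(1) Icarr by blast
    have "i \<otimes>\<^bsub>R\<^esub> r \<in> PIdl\<^bsub>R\<^esub> y" if ir: "i \<in> ideal_pow R M k" "r \<in> almost_integral R y" for i r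
    proof -
      have rc: "r \<in> carrier R" using ir(2) by (simp add: almost_integral_def)
      obtain w where w: "w \<in> carrier R" "i = x [^]\<^bsub>R\<^esub> K \<otimes>\<^bsub>R\<^esub> w"
        using k ir(1) PIdl_iff[of "x [^]\<^bsub>R\<^esub> K"] by blast
      have "x [^]\<^bsub>R\<^esub> K \<otimes>\<^bsub>R\<^esub> r \<in> PIdl\<^bsub>R\<^esub> y"
        unfolding K_def by (rule uniform_multiplier[OF L yc _ ir(2)]) (use x y in simp_all)
      hence "w \<otimes>\<^bsub>R\<^esub> (x [^]\<^bsub>R\<^esub> K \<otimes>\<^bsub>R\<^esub> r) \<in> PIdl\<^bsub>R\<^esub> y"
        by (rule ideal.I_l_closed[OF cgenideal_ideal[OF yc] _ w(1)])
      moreover have "i \<otimes>\<^bsub>R\<^esub> r = w \<otimes>\<^bsub>R\<^esub> (x [^]\<^bsub>R\<^esub> K \<otimes>\<^bsub>R\<^esub> r)"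
        unfolding w(2) using w(1) rc by (simp add: m_ac)
      ultimately show ?thesis by simp
    qed
    thus ?thesis unfolding y(2) by (intro goto_number_bound[OF assms(2) y(1,3)])
  qed
  hence "goto_numbers R M \<subseteq> {..k}" by (auto simp: goto_numbers_def)
  thus ?thesis by (rule finite_subset) simp
qed

end
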